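(* Let $p,q$ be nonnegative integers with $p\ne q$, $p\neq 0$, $q\ne 0$, and $q\notin\{p+1,p+2\}$, and let $m=\min\{p,q\}$. Then there exist a primitive idempotent $h$ of the Clifford algebra $\mathbb{R}_{p,q}$ and a factor $\tilde f$ of $h$ that recovers by projection a $\mathrm{U}(m)$-structure on $\mathbb{R}^{2m}$; that is, $h=\tilde f e$ for some $e\in\mathbb{R}_{p,q}$. Moreover, the image of $h=\tilde f e$ in $\bigwedge^\bullet(\mathbb{R}^{p+q})^*$ under the symbol map splits as the product $$\sigma^*(h)=P^{\mathbb{Q}}(\tilde\omega_0)\wedge\sigma^*(e),$$ where $\tilde\omega_0$ is a $2$-form on $\mathbb{R}^{p+q}$ isomorphic to the Kähler form on $\mathbb{R}^{2m}$ that defines the $\mathrm{U}(m)$-structure recovered by projection on $\mathbb{R}^{2m}$.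
   Context: Clifford algebra: $\mathbb{R}_{p,q}$ is the real unital associative algebra generated by $e_1,\dots,e_{p+q}$ with $e_ie_j=-e_je_i$ for $i\ne j$, $e_i^2=1$ for $1\le i\le p$ and $e_i^2=-1$ for $p+1\le i\le p+q$. It has the canonical basis $1$ and $e_{i_1}\cdots e_{i_k}$, $i_1<\cdots<i_k$. Symbol map: $\sigma^*:\mathbb{R}_{p,q}\to\bigwedge^\bullet(\mathbb{R}^{p+q})^*$ is the vector space isomorphism with $\sigma^*(1)=1$ and $\sigma^*(e_{i_1}\cdots e_{i_k})=e^{i_1}\wedge\cdots\wedge e^{i_k}$ for $i_1<\cdots<i_k$, where $e^1,\dots,e^{p+q}$ is the dual basis of the standard basis. Primitive idempotent: a nonzero $h$ with $h^2=h$ that is not a sum of two nonzero orthogonal idempotents; $\mathbb{R}_{p,q}h$ is then a minimal left ideal. $\mathrm{U}(m)$-structure on $\mathbb{R}^{2m}$: the triple $(J_0,\omega_0,g_0)$ with $g_0$ the standard inner product, $J_0(e_k)=e_{k+m}$, $J_0(e_{k+m})=-e_k$ for $k=1,\dots,m$, and Kähler form $\omega_0=g_0(J_0\cdot,\cdot)=e^1\wedge e^{m+1}+\cdots+e^m\wedge e^{2m}$. Since $g_0$ is given, recovering $\omega_0$ is regarded as recovering the structure. Recovered by projection: a $\mathrm{G}$-structure defined by forms $\phi_1,\dots,\phi_k\in\bigwedge^\bullet(\mathbb{R}^{n})^*$, $n<p+q$, is recovered by projection from $\tilde f\in\mathbb{R}_{p,q}$ if $\tilde f$ lies in a subalgebra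 $A\subset\mathbb{R}_{p,q}$, generated by $n$ of the basis vectors $e_i$, with $A\cong\mathbb{R}_{r,s}$, $r+s=n$, such that, identifying $\sigma^*(A)$ with $\bigwedge^\bullet(\mathbb{R}^n)^*$ (by relabelling the basis vectors), $\phi_i=\sigma^*|_A(\psi_i(\tilde f))$ for algebraic expressions $\psi_i(\tilde f)\in A$ in the graded components of $\tilde f$ (the degree-$k$ graded component being the part in the span of the canonical basis elements $e_{i_1}\cdots e_{i_k}$). Factor: such an $\tilde f\in A$ is called a factor of the primitive idempotent $h\in\mathbb{R}_{p,q}$ (recovering the $\mathrm{G}$-structure) if $h=\tilde f e$ (Clifford product) for some $e\in\mathbb{R}_{p,q}$. The $2$-form $\tilde\omega_0\in\sigma^*(A)\subset\bigwedge^\bullet(\mathbb{R}^{p+q})^*$ is "isomorphic to the Kähler form $\omega_0$" if it corresponds to $\omega_0$ under the identification of $\sigma^*(A)$ with $\bigwedge^\bullet(\mathbb{R}^{2m})^*$ above, and $P^{\mathbb{Q}}(\tilde\omega_0)=\frac{1}{2^m}\sum_{k=0}^{m}\frac{\tilde\omega_0^k}{k!}$ (wedge powers, $\tilde\omega_0^0=1$). *)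

theory Defs
  imports "HOL-Analysis.Analysis" "HOL-Analysis.Finite_Function_Topology"
begin

section \<open>Multivectors\<close>

text \<open>
  A multivector is the finite family of its real coefficients with respect to a basis indexed by
  the finite sets \<open>{i\<^sub>1 < \<dots> < i\<^sub>k}\<close> of natural numbers. The index set stands for the
  product \<open>e\<^sub>i\<^sub>1 \<dots> e\<^sub>i\<^sub>k\<close> in the Clifford algebra, and for the wedge product of the corresponding
  dual basis vectors in the exterior algebra.
\<close>

type_synonym multivector = "nat set \<Rightarrow>\<^sub>0 real"

definition multivectors :: "nat \<Rightarrow> multivector set" where
  "multivectors n = {x. \<forall>A\<in>Poly_Mapping.keys x. A \<subseteq> {1..n}}"

definition mv_one :: multivector where
  "mv_one = Poly_Mapping.single {} 1"

definition reorder_sign :: "nat set \<Rightarrow> nat set \<Rightarrow> real" where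
  "reorder_sign A B = (- 1) ^ card {(a, b). a \<in> A \<and> b \<in> B \<and> b < a}"

text \<open>
  The bilinear product of the algebra with anticommuting generators whose squares are the scalars
  \<open>Q i\<close>. Sorting the concatenation of two increasing products costs one sign for every inversion;
  afterwards each generator common to both factors occurs twice in a row and contracts to
  \<open>Q i\<close>. For \<open>Q = 0\<close> this is the wedge product.
\<close>

definition diag_prod :: "(nat \<Rightarrow> real) \<Rightarrow> multivector \<Rightarrow> multivector \<Rightarrow> multivector" where
  "diag_prod Q x y =
    (\<Sum>A\<in>Poly_Mapping.keys x. \<Sum>B\<in>Poly_Mapping.keys y.
       Poly_Mapping.single (sym_diff A B)
         (Poly_Mapping.lookup x A * Poly_Mapping.lookup y B * reorder_sign A B * (\<Prod>i\<in>A \<inter> B. Q i)))"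


lemma lookup_scaleR [simp]:
  "Poly_Mapping.lookup (c *\<^sub>R x) A = c *\<^sub>R Poly_Mapping.lookup (x :: 'a \<Rightarrow>\<^sub>0 'b::real_vector) A"
proof -
  have "finite {i. c *\<^sub>R Poly_Mapping.lookup x i \<noteq> 0}"
    by (rule finite_subset[OF _ finite_lookup[of x]]) auto
  then show ?thesis
    by (simp add: scaleR_poly_mapping_def)
qed

lemma reorder_sign_increasing:
  assumes "\<And>a b. a \<in> A \<Longrightarrow> b \<in> B \<Longrightarrow> a \<le> b"
  shows "reorder_sign A B = 1"
proof -
  have "{(a, b). a \<in> A \<and> b \<in> B \<and> b < a} = {}"
    using assms by (auto simp: not_less[symmetric])
  then show ?thesis
    unfolding reorder_sign_def by (simp only: card.empty power_0)
qed

lemma reorder_sign_prod: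
  assumes "finite A" "finite B"
  shows "reorder_sign A B = (\<Prod>a\<in>A. \<Prod>b\<in>B. if b < a then - 1 else 1)"
proof -
  have "(\<Prod>a\<in>A. \<Prod>b\<in>B. if b < a then - 1 else (1::real)) =
        (\<Prod>z\<in>A \<times> B. if snd z < fst z then - 1 else 1)"
    by (simp add: prod.cartesian_product case_prod_beta)
  also have "\<dots> = (\<Prod>z\<in>{z \<in> A \<times> B. snd z < fst z}. - 1)"
    using assms by (subst prod.inter_filter) auto
  also have "\<dots> = (- 1) ^ card {z \<in> A \<times> B. snd z < fst z}"
    by simp
  also have "{z \<in> A \<times> B. snd z < fst z} = {(a, b). a \<in> A \<and> b \<in> B \<and> b < a}"
    by auto
  finally show ?thesis
    by (simp add: reorder_sign_def)
qed

lemma prod_sym_diff: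
  fixes f :: "nat \<Rightarrow> real"
  assumes "finite A" "finite B" and "\<And>i. f i * f i = 1"
  shows "prod f (sym_diff A B) = prod f A * prod f B"
proof -
  have A: "prod f A = prod f (A - B) * prod f (A \<inter> B)"
    using assms by (metis Diff_disjoint Int_Diff_Un Int_Diff_disjoint finite_Diff finite_Int
        mult.commute prod.union_disjoint)
  have B: "prod f B = prod f (B - A) * prod f (A \<inter> B)"
    using assms by (metis Int_Diff_Un Int_Diff_disjoint finite_Diff finite_Int inf_commute
        mult.commute prod.union_disjoint)
  have "prod f (A \<inter> B) * prod f (A \<inter> B) = 1"
    by (simp flip: prod.distrib add: assms)
  moreover have "prod f (sym_diff A B) = prod f (A - B) * prod f (B - A)"
    using assms by (intro prod.union_disjoint) auto
  ultimately show ?thesis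
    by (simp add: A B mult.assoc mult.left_commute)
qed

lemma reorder_sign_sym_diff_left:
  assumes "finite A" "finite B" "finite C"
  shows "reorder_sign (sym_diff A B) C = reorder_sign A C * reorder_sign B C"
proof -
  have "(\<Prod>c\<in>C. if c < i then - 1 else (1::real)) * (\<Prod>c\<in>C. if c < i then - 1 else 1) = 1" for i
    unfolding prod.distrib[symmetric] by (rule prod.neutral) simp
  then show ?thesis
    using assms by (simp add: reorder_sign_prod prod_sym_diff)
qed

lemma reorder_sign_sym_diff_right:
  assumes "finite A" "finite B" "finite C"
  shows "reorder_sign A (sym_diff B C) = reorder_sign A B * reorder_sign A C"
  using assms by (simp add: reorder_sign_prod prod_sym_diff flip: prod.distrib)

lemma blade_coeff_assoc:
  fixes Q :: "nat \<Rightarrow> real"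
  assumes "finite A" "finite B" "finite C"
  shows "(reorder_sign A B * (\<Prod>i\<in>A \<inter> B. Q i)) *
           (reorder_sign (sym_diff A B) C * (\<Prod>i\<in>sym_diff A B \<inter> C. Q i)) =
         (reorder_sign B C * (\<Prod>i\<in>B \<inter> C. Q i)) *
           (reorder_sign A (sym_diff B C) * (\<Prod>i\<in>A \<inter> sym_diff B C. Q i))"
proof -
  have "prod Q (A \<inter> B) * prod Q (sym_diff A B \<inter> C) = prod Q (A \<inter> B \<union> sym_diff A B \<inter> C)"
    using assms by (intro prod.union_disjoint[symmetric]) auto
  also have "A \<inter> B \<union> sym_diff A B \<inter> C = B \<inter> C \<union> A \<inter> sym_diff B C"
    by auto
  also have "prod Q \<dots> = prod Q (B \<inter> C) * prod Q (A \<inter> sym_diff B C)"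
    using assms by (intro prod.union_disjoint) auto
  finally show ?thesis
    using assms
    by (simp add: reorder_sign_sym_diff_left reorder_sign_sym_diff_right mult_ac)
qed

lemma diag_prod_superset:
  assumes "finite S" "finite T" "Poly_Mapping.keys x \<subseteq> S" "Poly_Mapping.keys y \<subseteq> T"
  shows "diag_prod Q x y =
    (\<Sum>A\<in>S. \<Sum>B\<in>T. Poly_Mapping.single (sym_diff A B)
       (Poly_Mapping.lookup x A * Poly_Mapping.lookup y B * reorder_sign A B * (\<Prod>i\<in>A \<inter> B. Q i)))"
proof -
  let ?g = "\<lambda>A B. Poly_Mapping.single (sym_diff A B)
       (Poly_Mapping.lookup x A * Poly_Mapping.lookup y B * reorder_sign A B * (\<Prod>i\<in>A \<inter> B. Q i))"
  have "(\<Sum>B\<in>Poly_Mapping.keys y. ?g A B) = (\<Sum>B\<in>T. ?g A B)" for A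
    using assms by (intro sum.mono_neutral_left) (auto simp: in_keys_iff)
  moreover have "(\<Sum>A\<in>Poly_Mapping.keys x. \<Sum>B\<in>T. ?g A B) = (\<Sum>A\<in>S. \<Sum>B\<in>T. ?g A B)"
    using assms by (intro sum.mono_neutral_left) (auto simp: in_keys_iff)
  ultimately show ?thesis
    by (simp add: diag_prod_def)
qed

lemma diag_prod_single:
  "diag_prod Q (Poly_Mapping.single A a) (Poly_Mapping.single B b) =
    Poly_Mapping.single (sym_diff A B) (a * b * (reorder_sign A B * (\<Prod>i\<in>A \<inter> B. Q i)))"
  by (subst diag_prod_superset[where S = "{A}" and T = "{B}"]) (auto simp: mult.assoc)

lemma diag_prod_add_left: "diag_prod Q (x + y) z = diag_prod Q x z + diag_prod Q y z"
  using keys_add[of x y]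
  by (simp add: diag_prod_superset[where S = "Poly_Mapping.keys x \<union> Poly_Mapping.keys y"
        and T = "Poly_Mapping.keys z"] lookup_add distrib_right single_add sum.distrib)

lemma diag_prod_add_right: "diag_prod Q x (y + z) = diag_prod Q x y + diag_prod Q x z"
  using keys_add[of y z]
  by (simp add: diag_prod_superset[where T = "Poly_Mapping.keys y \<union> Poly_Mapping.keys z"
        and S = "Poly_Mapping.keys x"] lookup_add distrib_left distrib_right single_add sum.distrib)

lemma single_eq_scaleR: "Poly_Mapping.single A (c * a) = c *\<^sub>R Poly_Mapping.single A (a::real)"
  by (rule poly_mapping_eqI) (simp add: lookup_single when_def)

lemma keys_scaleR_subset: "Poly_Mapping.keys (c *\<^sub>R (x :: multivector)) \<subseteq> Poly_Mapping.keys x"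
  by (auto simp: in_keys_iff)

lemma diag_prod_scaleR_left: "diag_prod Q (c *\<^sub>R x) y = c *\<^sub>R diag_prod Q x y"
  using keys_scaleR_subset[of c x]
  by (simp add: diag_prod_superset[where S = "Poly_Mapping.keys x" and T = "Poly_Mapping.keys y"]
      scaleR_sum_right mult.assoc single_eq_scaleR)

lemma diag_prod_scaleR_right: "diag_prod Q x (c *\<^sub>R y) = c *\<^sub>R diag_prod Q x y"
  using keys_scaleR_subset[of c y]
  by (simp add: diag_prod_superset[where S = "Poly_Mapping.keys x" and T = "Poly_Mapping.keys y"]
      scaleR_sum_right mult.assoc mult.left_commute[of _ c] single_eq_scaleR)

lemma linear_diag_prod_left: "linear (\<lambda>x. diag_prod Q x y)"
  by (simp add: diag_prod_add_left diag_prod_scaleR_left linearI)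

lemma linear_diag_prod_right: "linear (diag_prod Q x)"
  by (simp add: diag_prod_add_right diag_prod_scaleR_right linearI)

lemma multivector_expansion:
  "x = (\<Sum>A\<in>Poly_Mapping.keys x. Poly_Mapping.single A (Poly_Mapping.lookup x A))"
  by (rule poly_mapping_eqI) (auto simp: lookup_sum lookup_single when_def in_keys_iff)

lemma diag_prod_assoc:
  assumes "\<forall>A\<in>Poly_Mapping.keys x \<union> Poly_Mapping.keys y \<union> Poly_Mapping.keys z. finite A"
  shows "diag_prod Q (diag_prod Q x y) z = diag_prod Q x (diag_prod Q y z)"
proof -
  let ?s = "\<lambda>u A. Poly_Mapping.single A (Poly_Mapping.lookup u A) :: multivector"
  have blades: "diag_prod Q (diag_prod Q (?s x A) (?s y B)) (?s z C) =
        diag_prod Q (?s x A) (diag_prod Q (?s y B) (?s z C))"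
    if "finite A" "finite B" "finite C" for A B C
  proof -
    have "sym_diff (sym_diff A B) C = sym_diff A (sym_diff B C)"
      by auto
    then show ?thesis
      using arg_cong[OF blade_coeff_assoc[OF that, of Q], of "\<lambda>r. Poly_Mapping.lookup x A *
          (Poly_Mapping.lookup y B * (Poly_Mapping.lookup z C * r))"]
      by (simp only: diag_prod_single mult_ac)
  qed
  have "diag_prod Q (diag_prod Q x y) z = diag_prod Q (diag_prod Q
      (\<Sum>A\<in>Poly_Mapping.keys x. ?s x A) (\<Sum>B\<in>Poly_Mapping.keys y. ?s y B))
      (\<Sum>C\<in>Poly_Mapping.keys z. ?s z C)"
    by (simp flip: multivector_expansion)
  also have "\<dots> = (\<Sum>C\<in>Poly_Mapping.keys z. \<Sum>B\<in>Poly_Mapping.keys y. \<Sum>A\<in>Poly_Mapping.keys x.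
      diag_prod Q (diag_prod Q (?s x A) (?s y B)) (?s z C))"
    by (simp only: linear_sum[OF linear_diag_prod_left] linear_sum[OF linear_diag_prod_right])
  also have "\<dots> = (\<Sum>C\<in>Poly_Mapping.keys z. \<Sum>B\<in>Poly_Mapping.keys y. \<Sum>A\<in>Poly_Mapping.keys x.
      diag_prod Q (?s x A) (diag_prod Q (?s y B) (?s z C)))"
    using assms by (intro sum.cong refl blades) auto
  also have "\<dots> = diag_prod Q (\<Sum>A\<in>Poly_Mapping.keys x. ?s x A) (diag_prod Q
      (\<Sum>B\<in>Poly_Mapping.keys y. ?s y B) (\<Sum>C\<in>Poly_Mapping.keys z. ?s z C))"
    by (simp only: linear_sum[OF linear_diag_prod_left] linear_sum[OF linear_diag_prod_right])
  finally show ?thesis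
    by (simp flip: multivector_expansion)
qed

lemma diag_prod_one_left: "diag_prod Q mv_one x = x"
  by (subst (2) multivector_expansion)
    (simp add: mv_one_def diag_prod_def reorder_sign_def)

lemma diag_prod_one_right: "diag_prod Q x mv_one = x"
  by (subst (2) multivector_expansion)
    (simp add: mv_one_def diag_prod_def reorder_sign_def)

text \<open>The index set \<open>{i\<^sub>1 < \<dots> < i\<^sub>k}\<close> does name the product of the generators in increasing order.\<close>

lemma diag_prod_increasing:
  assumes "sorted_wrt (<) is"
  shows "foldr (diag_prod Q) (map (\<lambda>i. Poly_Mapping.single {i} 1) is) mv_one =
    Poly_Mapping.single (set is) 1"
  using assms
proof (induction "is")
  case Nil
  then show ?case by (simp add: mv_one_def)
next
  case (Cons i "is")
  then have "reorder_sign {i} (set is) = 1" "i \<notin> set is"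
    by (auto intro!: reorder_sign_increasing)
  then have "reorder_sign {i} (set is) = 1" "sym_diff {i} (set is) = insert i (set is)"
    "{i} \<inter> set is = {}"
    by auto
  with Cons show ?case
    by (simp add: diag_prod_single)
qed


section \<open>Clifford algebra, exterior algebra, symbol map\<close>

text \<open>
  The product of \<open>\<real>\<^sub>p\<^sub>,\<^sub>q\<close> on \<open>multivectors (p + q)\<close>; it depends on \<open>q\<close> only through the carrier.
\<close>

definition clifford_mult :: "nat \<Rightarrow> multivector \<Rightarrow> multivector \<Rightarrow> multivector" where
  "clifford_mult p = diag_prod (\<lambda>i. if i \<le> p then 1 else - 1)"

abbreviation clifford :: "nat \<Rightarrow> nat \<Rightarrow> multivector set" where
  "clifford p q \<equiv> multivectors (p + q)"

definition clifford_gen :: "nat \<Rightarrow> multivector" where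
  "clifford_gen i = Poly_Mapping.single {i} 1"

lemma clifford_gen_square:
  "clifford_mult p (clifford_gen i) (clifford_gen i) = (if i \<le> p then 1 else - 1) *\<^sub>R mv_one"
  using reorder_sign_increasing[of "{i}" "{i}"]
  by (simp add: clifford_mult_def clifford_gen_def mv_one_def diag_prod_single
      flip: single_eq_scaleR)

lemma clifford_gen_anticommute:
  assumes "i \<noteq> j"
  shows "clifford_mult p (clifford_gen i) (clifford_gen j) =
    - clifford_mult p (clifford_gen j) (clifford_gen i)"
proof -
  have "{(a, b). a \<in> {i} \<and> b \<in> {j} \<and> b < a} = (if j < i then {(i, j)} else {})" for i j :: nat
    by auto
  with assms show ?thesis
    by (auto simp: clifford_mult_def clifford_gen_def diag_prod_single reorder_sign_def
        insert_commute simp flip: single_uminus)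
qed

text \<open>The exterior algebra of the dual of \<open>\<real>\<^sup>n\<close> has carrier \<open>multivectors n\<close> as well.\<close>

definition wedge :: "multivector \<Rightarrow> multivector \<Rightarrow> multivector" (infixl "\<and>\<^sub>\<Lambda>" 70) where
  "wedge = diag_prod (\<lambda>i. 0)"

abbreviation forms :: "nat \<Rightarrow> multivector set" where
  "forms n \<equiv> multivectors n"

definition dual_vec :: "nat \<Rightarrow> multivector" where
  "dual_vec i = Poly_Mapping.single {i} 1"

definition wedge_list :: "multivector list \<Rightarrow> multivector" where
  "wedge_list xs = foldr (\<and>\<^sub>\<Lambda>) xs mv_one"

definition wedge_power :: "multivector \<Rightarrow> nat \<Rightarrow> multivector" where
  "wedge_power x k = (((\<and>\<^sub>\<Lambda>) x) ^^ k) mv_one"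

definition symbol_map :: "multivector \<Rightarrow> multivector" where
  "symbol_map x =
    (\<Sum>A\<in>Poly_Mapping.keys x.
       Poly_Mapping.lookup x A *\<^sub>R wedge_list (map dual_vec (sorted_list_of_set A)))"

lemma symbol_map_canonical_basis:
  assumes "sorted_wrt (<) is"
  shows "symbol_map (foldr (clifford_mult p) (map clifford_gen is) mv_one) =
    wedge_list (map dual_vec is)"
proof -
  have "foldr (clifford_mult p) (map clifford_gen is) mv_one = Poly_Mapping.single (set is) 1"
    using diag_prod_increasing[OF assms] by (simp add: clifford_mult_def clifford_gen_def[abs_def])
  moreover have "sorted_list_of_set (set is) = is"
    using assms by (simp add: strict_sorted_iff sorted_list_of_set_sort_remdups
        sorted_sort_id distinct_remdups_id)
  ultimately show ?thesis
    by (simp add: symbol_map_def)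
qed

definition grade_part :: "nat \<Rightarrow> multivector \<Rightarrow> multivector" where
  "grade_part k x =
    (\<Sum>A\<in>{A \<in> Poly_Mapping.keys x. card A = k}. Poly_Mapping.single A (Poly_Mapping.lookup x A))"


section \<open>Primitive idempotents\<close>

definition idempotent :: "nat \<Rightarrow> multivector \<Rightarrow> bool" where
  "idempotent p x \<longleftrightarrow> clifford_mult p x x = x"

definition primitive_idempotent :: "nat \<Rightarrow> nat \<Rightarrow> multivector \<Rightarrow> bool" where
  "primitive_idempotent p q h \<longleftrightarrow>
    h \<in> clifford p q \<and> h \<noteq> 0 \<and> idempotent p h \<and>
    \<not> (\<exists>a\<in>clifford p q. \<exists>b\<in>clifford p q.
          a \<noteq> 0 \<and> b \<noteq> 0 \<and> idempotent p a \<and> idempotent p b \<and>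
          clifford_mult p a b = 0 \<and> clifford_mult p b a = 0 \<and> h = a + b)"


section \<open>Structures recovered by projection\<close>

definition clifford_subalgebra :: "nat \<Rightarrow> multivector set \<Rightarrow> multivector set" where
  "clifford_subalgebra p E =
    (\<lambda>S. subspace S \<and> mv_one \<in> S \<and> (\<forall>x\<in>S. \<forall>y\<in>S. clifford_mult p x y \<in> S)) hull E"

lemma clifford_subalgebra_clifford_gen:
  assumes "finite I"
  shows "clifford_subalgebra p (clifford_gen ` I) = {x. \<forall>A\<in>Poly_Mapping.keys x. A \<subseteq> I}"
    (is "?L = ?R")
proof
  have "clifford_mult p x y \<in> ?R" if "x \<in> ?R" "y \<in> ?R" for x y
  proof -
    have "Poly_Mapping.keys (clifford_mult p x y) \<subseteq>
        (\<Union>A\<in>Poly_Mapping.keys x. \<Union>B\<in>Poly_Mapping.keys y. {sym_diff A B})"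
      unfolding clifford_mult_def diag_prod_def
      by (intro order_trans[OF keys_sum] UN_mono subset_refl) simp
    with that show ?thesis
      by blast
  qed
  moreover have "subspace ?R"
    using keys_add keys_scaleR_subset by (fastforce simp: subspace_def)
  moreover have "mv_one \<in> ?R" "clifford_gen ` I \<subseteq> ?R"
    by (auto simp: mv_one_def clifford_gen_def)
  ultimately show "?L \<subseteq> ?R"
    unfolding clifford_subalgebra_def
    by (intro hull_minimal conjI ballI)
next
  have "x \<in> S" if x: "x \<in> ?R" and gens: "clifford_gen ` I \<subseteq> S" and "subspace S" "mv_one \<in> S"
    and mult: "\<And>x y. x \<in> S \<Longrightarrow> y \<in> S \<Longrightarrow> clifford_mult p x y \<in> S" for x S
  proof -
    have "Poly_Mapping.single A a \<in> S" if "A \<subseteq> I" for A a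
    proof -
      define l where "l = sorted_list_of_set A"
      have "finite A"
        using that assms by (rule finite_subset)
      then have l: "set l = A" "sorted_wrt (<) l"
        by (simp_all add: l_def)
      have "foldr (clifford_mult p) (map clifford_gen l') mv_one \<in> S" if "set l' \<subseteq> I" for l'
        using that gens \<open>mv_one \<in> S\<close> by (induction l') (auto intro!: mult)
      then have "foldr (clifford_mult p) (map clifford_gen l) mv_one \<in> S"
        using l(1) \<open>A \<subseteq> I\<close> by simp
      then have "Poly_Mapping.single A 1 \<in> S"
        using diag_prod_increasing[OF l(2)] l(1)
        by (simp add: clifford_mult_def clifford_gen_def[abs_def])
      from subspace_scale[OF \<open>subspace S\<close> this, of a] show ?thesis
        by (simp flip: single_eq_scaleR)
    qed
    with x have "(\<Sum>A\<in>Poly_Mapping.keys x. Poly_Mapping.single A (Poly_Mapping.lookup x A)) \<in> S"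
      by (intro subspace_sum[OF \<open>subspace S\<close>]) auto
    then show "x \<in> S"
      by (simp flip: multivector_expansion)
  qed
  then show "?R \<subseteq> ?L"
    by (auto simp: clifford_subalgebra_def hull_def)
qed

corollary clifford_eq_subalgebra:
  "clifford p q = clifford_subalgebra p (clifford_gen ` {1..p + q})"
  by (simp add: clifford_subalgebra_clifford_gen multivectors_def)

definition clifford_isomorphic ::
  "nat \<Rightarrow> multivector set \<Rightarrow> nat \<Rightarrow> multivector set \<Rightarrow> bool" where
  "clifford_isomorphic p S p' T \<longleftrightarrow>
    (\<exists>\<phi>. bij_betw \<phi> S T \<and> \<phi> mv_one = mv_one \<and>
      (\<forall>x\<in>S. \<forall>y\<in>S. \<phi> (x + y) = \<phi> x + \<phi> y) \<and>
      (\<forall>c. \<forall>x\<in>S. \<phi> (c *\<^sub>R x) = c *\<^sub>R \<phi> x) \<and>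
      (\<forall>x\<in>S. \<forall>y\<in>S. \<phi> (clifford_mult p x y) = clifford_mult p' (\<phi> x) (\<phi> y)))"

text \<open>Algebraic expressions in the graded components of a single Clifford element.\<close>

datatype graded_expr =
    Component nat
  | Scalar real
  | Plus graded_expr graded_expr
  | Times graded_expr graded_expr

primrec eval_expr :: "nat \<Rightarrow> multivector \<Rightarrow> graded_expr \<Rightarrow> multivector" where
  "eval_expr p f (Component k) = grade_part k f"
| "eval_expr p f (Scalar c) = c *\<^sub>R mv_one"
| "eval_expr p f (Plus a b) = eval_expr p f a + eval_expr p f b"
| "eval_expr p f (Times a b) = clifford_mult p (eval_expr p f a) (eval_expr p f b)"

text \<open>
  The homomorphism of exterior algebras with \<open>dual_vec i \<mapsto> dual_vec (\<iota> i)\<close>; for \<open>\<iota>\<close> injective on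
  \<open>{1..n}\<close> it identifies \<open>forms n\<close> with the forms in the variables \<open>\<iota> ` {1..n}\<close>. If \<open>\<iota>\<close> is not
  increasing, \<open>wedge_list\<close> supplies the signs.
\<close>

definition relabel :: "(nat \<Rightarrow> nat) \<Rightarrow> multivector \<Rightarrow> multivector" where
  "relabel \<iota> x =
    (\<Sum>A\<in>Poly_Mapping.keys x.
       Poly_Mapping.lookup x A *\<^sub>R wedge_list (map (\<lambda>i. dual_vec (\<iota> i)) (sorted_list_of_set A)))"

text \<open>
  The structure on \<open>\<real>\<^sup>n\<close> defined by the forms \<open>\<Phi>\<close> is recovered by projection from \<open>f\<close>. The injection
  \<open>\<iota>\<close> selects the \<open>n\<close> basis vectors that generate the subalgebra and is the relabelling which
  identifies its image under the symbol map with \<open>forms n\<close>.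
\<close>

definition recovers_by_projection ::
  "nat \<Rightarrow> nat \<Rightarrow> nat \<Rightarrow> multivector set \<Rightarrow> (nat \<Rightarrow> nat) \<Rightarrow> multivector \<Rightarrow> bool" where
  "recovers_by_projection p q n \<Phi> \<iota> f \<longleftrightarrow>
    n < p + q \<and> finite \<Phi> \<and> \<Phi> \<subseteq> forms n \<and>
    inj_on \<iota> {1..n} \<and> \<iota> ` {1..n} \<subseteq> {1..p + q} \<and>
    (let A = clifford_subalgebra p (clifford_gen ` \<iota> ` {1..n}) in
      f \<in> A \<and>
      (\<exists>r s. r + s = n \<and> clifford_isomorphic p A r (clifford r s)) \<and>
      (\<forall>\<phi>\<in>\<Phi>. \<exists>\<psi>. eval_expr p f \<psi> \<in> A \<and> symbol_map (eval_expr p f \<psi>) = relabel \<iota> \<phi>))"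

definition recovering_factor ::
  "nat \<Rightarrow> nat \<Rightarrow> nat \<Rightarrow> multivector set \<Rightarrow> (nat \<Rightarrow> nat) \<Rightarrow> multivector \<Rightarrow> multivector \<Rightarrow> bool" where
  "recovering_factor p q n \<Phi> \<iota> h f \<longleftrightarrow>
    recovers_by_projection p q n \<Phi> \<iota> f \<and> (\<exists>e\<in>clifford p q. h = clifford_mult p f e)"


section \<open>The standard unitary structure\<close>

text \<open>
  Vectors of \<open>\<real>\<^sup>2\<^sup>m\<close> are functions on \<open>nat\<close> of which only the values on \<open>{1..2 * m}\<close> matter.
\<close>

definition g0 :: "nat \<Rightarrow> (nat \<Rightarrow> real) \<Rightarrow> (nat \<Rightarrow> real) \<Rightarrow> real" where
  "g0 m u v = (\<Sum>i=1..2 * m. u i * v i)"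

definition J0 :: "nat \<Rightarrow> (nat \<Rightarrow> real) \<Rightarrow> nat \<Rightarrow> real" where
  "J0 m v = (\<lambda>i. if 1 \<le> i \<and> i \<le> m then - v (i + m)
                  else if m + 1 \<le> i \<and> i \<le> 2 * m then v (i - m) else 0)"

definition kahler_form :: "nat \<Rightarrow> multivector" where
  "kahler_form m = (\<Sum>k=1..m. dual_vec k \<and>\<^sub>\<Lambda> dual_vec (m + k))"

text \<open>The value of the degree-two part of \<open>\<omega>\<close> on two vectors.\<close>

definition apply_two_form :: "multivector \<Rightarrow> (nat \<Rightarrow> real) \<Rightarrow> (nat \<Rightarrow> real) \<Rightarrow> real" where
  "apply_two_form \<omega> u v =
    (\<Sum>A\<in>{A \<in> Poly_Mapping.keys \<omega>. card A = 2}.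
       Poly_Mapping.lookup \<omega> A * (u (Min A) * v (Max A) - u (Max A) * v (Min A)))"

lemma kahler_form_eq_g0_J0: "apply_two_form (kahler_form m) u v = g0 m (J0 m u) v"
proof -
  have wedge_eq: "dual_vec k \<and>\<^sub>\<Lambda> dual_vec (m + k) = Poly_Mapping.single {k, m + k} 1"
    if "k \<in> {1..m}" for k
  proof -
    have "m \<noteq> 0"
      using that by auto
    then have "reorder_sign {k} {m + k} = 1" "sym_diff {k} {m + k} = {k, m + k}"
      by (auto intro!: reorder_sign_increasing)
    then show ?thesis
      using \<open>m \<noteq> 0\<close> by (simp add: wedge_def dual_vec_def diag_prod_single)
  qed
  let ?P = "(\<lambda>k. {k, m + k}) ` {1..m}"
  have inj: "inj_on (\<lambda>k. {k, m + k}) {1..m}"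
    by (rule inj_onI) (auto simp: doubleton_eq_iff)
  have "kahler_form m = (\<Sum>k=1..m. Poly_Mapping.single {k, m + k} 1)"
    by (simp add: kahler_form_def wedge_eq)
  also have "\<dots> = (\<Sum>A\<in>?P. Poly_Mapping.single A 1)"
    using inj by (simp add: sum.reindex)
  finally have lookup: "Poly_Mapping.lookup (kahler_form m) A = (if A \<in> ?P then 1 else 0)" for A
    by (simp add: lookup_sum lookup_single when_def)
  then have "{A \<in> Poly_Mapping.keys (kahler_form m). card A = 2} = ?P"
    by (auto simp: in_keys_iff)
  then have "apply_two_form (kahler_form m) u v =
      (\<Sum>A\<in>?P. u (Min A) * v (Max A) - u (Max A) * v (Min A))"
    by (simp add: apply_two_form_def lookup)
  also have "\<dots> = (\<Sum>k=1..m. u k * v (m + k) - u (m + k) * v k)"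
    using inj by (simp add: sum.reindex max_def)
  finally have lhs: "apply_two_form (kahler_form m) u v = \<dots>" .
  have "g0 m (J0 m u) v = (\<Sum>i\<in>{1..m} \<union> (\<lambda>k. m + k) ` {1..m}. J0 m u i * v i)"
    unfolding g0_def by (rule sum.cong) (auto simp: image_iff intro: exI[of _ "_ - m"] dest: le_Suc_ex)
  also have "\<dots> = (\<Sum>i=1..m. J0 m u i * v i) + (\<Sum>i\<in>(\<lambda>k. m + k) ` {1..m}. J0 m u i * v i)"
    by (rule sum.union_disjoint) auto
  also have "(\<Sum>i=1..m. J0 m u i * v i) = (\<Sum>k=1..m. - u (m + k) * v k)"
    by (rule sum.cong) (auto simp: J0_def add.commute)
  also have "(\<Sum>i\<in>(\<lambda>k. m + k) ` {1..m}. J0 m u i * v i) = (\<Sum>k=1..m. u k * v (m + k))"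
    by (subst sum.reindex) (auto simp: J0_def intro!: sum.cong)
  finally show ?thesis
    by (simp add: lhs sum_subtractf sum_negf)
qed

definition PQ :: "nat \<Rightarrow> multivector \<Rightarrow> multivector" where
  "PQ m \<omega> = (1 / 2 ^ m) *\<^sub>R (\<Sum>k=0..m. (1 / fact k) *\<^sub>R wedge_power \<omega> k)"

end

theory Submission
  imports Defs
begin

text \<open>
  The bivectors \<open>e\<^sub>i e\<^sub>p\<^sub>+\<^sub>i\<close> for \<open>i \<le> m\<close> commute and square to \<open>1\<close>, so
  \<open>f = \<Prod>\<^sub>i (1 + e\<^sub>i e\<^sub>p\<^sub>+\<^sub>i) / 2\<close> is an idempotent; expanding the product gives the truncated
  exponential \<open>PQ m \<omega>\<close>, where \<open>\<omega>\<close> is \<open>2\<^sup>m\<close> times the degree-two component of \<open>f\<close>. The corner of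
  the Clifford algebra cut out by \<open>f\<close> is \<open>f R \<cong> R\<close>, where \<open>R\<close> is the subalgebra of the remaining
  generators. Hence \<open>h = f e\<close> is primitive for every primitive idempotent \<open>e\<close> of \<open>R\<close>, and one
  exists because \<open>R\<close> is finite-dimensional. Since \<open>f\<close> and \<open>e\<close> involve disjoint sets of generators,
  their Clifford product is their wedge product.
\<close>

section \<open>Multivectors with given generators\<close>

text \<open>The index set \<open>I\<close> is kept arbitrary so that one notion covers the whole
  algebra, the subalgebra of the paired generators, which contains \<open>f\<close>, and the
  subalgebra of the remaining ones.\<close>

definition supported :: "nat set \<Rightarrow> multivector set" where
  "supported I = {x. \<forall>A\<in>Poly_Mapping.keys x. A \<subseteq> I}"

lemma multivectors_eq_supported: "multivectors n = supported {1..n}"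
  by (simp add: multivectors_def supported_def)

lemma supported_mono: "I \<subseteq> J \<Longrightarrow> supported I \<subseteq> supported J"
  by (auto simp: supported_def)

lemma single_in_supported: "A \<subseteq> I \<Longrightarrow> Poly_Mapping.single A a \<in> supported I"
  by (auto simp: supported_def)

lemma mv_one_in_supported: "mv_one \<in> supported I"
  by (simp add: mv_one_def single_in_supported)

lemma subspace_supported: "subspace (supported I)"
  using keys_add keys_scaleR_subset by (fastforce simp: subspace_def supported_def)

text \<open>Blades span, so linear identities need only be checked on them;
  \<open>linear_eq_on_supported\<close> and \<open>supported_subset_subspace\<close> rest on
  this.\<close>

lemma supported_eq_span: "supported I = span ((\<lambda>A. Poly_Mapping.single A 1) ` Pow I)"
proof
  show "span ((\<lambda>A. Poly_Mapping.single A 1) ` Pow I) \<subseteq> supported I"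
    by (intro span_minimal subspace_supported) (auto intro: single_in_supported)
next
  show "supported I \<subseteq> span ((\<lambda>A. Poly_Mapping.single A 1) ` Pow I)"
  proof
    fix x assume x: "x \<in> supported I"
    \<comment> \<open>The factor \<open>* 1\<close> lets \<open>single_eq_scaleR\<close> pull each
      coefficient out of its blade.\<close>
    have "(\<Sum>A\<in>Poly_Mapping.keys x. Poly_Mapping.single A (Poly_Mapping.lookup x A * 1))
        \<in> span ((\<lambda>A. Poly_Mapping.single A 1) ` Pow I)"
      unfolding single_eq_scaleR
      using x by (intro span_sum span_scale span_base) (auto simp: supported_def)
    then show "x \<in> span ((\<lambda>A. Poly_Mapping.single A 1) ` Pow I)"
      by (simp flip: multivector_expansion)
  qed
qed

lemma supported_subset_subspace:
  assumes "subspace V" "\<And>A. A \<subseteq> I \<Longrightarrow> Poly_Mapping.single A 1 \<in> V"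
  shows "supported I \<subseteq> V"
  unfolding supported_eq_span using assms by (intro span_minimal) auto

lemma linear_eq_on_supported:
  assumes "linear F" "linear G" "x \<in> supported I"
    and "\<And>A. A \<subseteq> I \<Longrightarrow> F (Poly_Mapping.single A 1) = G (Poly_Mapping.single A 1)"
  shows "F x = G x"
  by (rule linear_eq_on_span[OF assms(1,2) _ assms(3)[unfolded supported_eq_span]])
    (use assms(4) in auto)

lemma diag_prod_in_supported:
  assumes "x \<in> supported I" "y \<in> supported J"
  shows "diag_prod Q x y \<in> supported (I \<union> J)"
  unfolding diag_prod_def using assms
  by (intro subspace_sum[OF subspace_supported] single_in_supported) (auto simp: supported_def)

section \<open>Clifford multiplication on supported multivectors\<close>

lemma clifford_mult_in_supported:
  "x \<in> supported I \<Longrightarrow> y \<in> supported I \<Longrightarrow> clifford_mult p x y \<in> supported I"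
  using diag_prod_in_supported[of x I y I] by (simp add: clifford_mult_def)

lemma clifford_mult_assoc:
  assumes "finite I" "x \<in> supported I" "y \<in> supported I" "z \<in> supported I"
  shows "clifford_mult p (clifford_mult p x y) z = clifford_mult p x (clifford_mult p y z)"
  unfolding clifford_mult_def
  by (rule diag_prod_assoc) (use assms in \<open>auto simp: supported_def intro: finite_subset[of _ I]\<close>)

lemma linear_clifford_mult_left: "linear (\<lambda>x. clifford_mult p x y)"
  unfolding clifford_mult_def by (rule linear_diag_prod_left)

lemma linear_clifford_mult_right: "linear (clifford_mult p x)"
  unfolding clifford_mult_def by (rule linear_diag_prod_right)

lemmas clifford_mult_simps =
  linear_add[OF linear_clifford_mult_left] linear_add[OF linear_clifford_mult_right]
  linear_0[OF linear_clifford_mult_left] linear_0[OF linear_clifford_mult_right]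
  linear_cmul[OF linear_clifford_mult_left] linear_cmul[OF linear_clifford_mult_right]

lemma clifford_mult_one_left: "clifford_mult p mv_one x = x"
  by (simp add: clifford_mult_def diag_prod_one_left)

lemma clifford_mult_one_right: "clifford_mult p x mv_one = x"
  by (simp add: clifford_mult_def diag_prod_one_right)

text \<open>The squares \<open>Q i\<close> enter only through generators common to two blades. With
  disjoint generators the Clifford and wedge products therefore agree.\<close>

lemma diag_prod_disjoint:
  assumes "x \<in> supported I" "y \<in> supported J" "I \<inter> J = {}"
  shows "diag_prod Q x y = diag_prod Q' x y"
proof -
  have "A \<inter> B = {}" if "A \<in> Poly_Mapping.keys x" "B \<in> Poly_Mapping.keys y" for A B
    using that assms by (fastforce simp: supported_def)
  then show ?thesis
    unfolding diag_prod_def by (intro sum.cong refl) simp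
qed

text \<open>The key set varies with \<open>x\<close>, so additivity is proved after extending all
  sums to a common finite set, where the extra coefficients vanish. Both \<open>symbol_map\<close>
  and \<open>relabel\<close> have this form.\<close>

lemma linear_keys_sum:
  fixes g :: "nat set \<Rightarrow> 'b::real_vector"
  defines "F \<equiv> \<lambda>x::multivector. \<Sum>A\<in>Poly_Mapping.keys x. Poly_Mapping.lookup x A *\<^sub>R g A"
  shows "linear F"
proof -
  have super: "F x = (\<Sum>A\<in>S. Poly_Mapping.lookup x A *\<^sub>R g A)"
    if "finite S" "Poly_Mapping.keys x \<subseteq> S" for x :: multivector and S
    unfolding F_def using that by (intro sum.mono_neutral_left) (auto simp: in_keys_iff)
  show ?thesis
  proof (rule linearI)
    fix x y :: multivector
    let ?S = "Poly_Mapping.keys x \<union> Poly_Mapping.keys y"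
    have "F x = (\<Sum>A\<in>?S. Poly_Mapping.lookup x A *\<^sub>R g A)"
      "F y = (\<Sum>A\<in>?S. Poly_Mapping.lookup y A *\<^sub>R g A)"
      "F (x + y) = (\<Sum>A\<in>?S. Poly_Mapping.lookup (x + y) A *\<^sub>R g A)"
      using keys_add[of x y] by (simp_all add: super)
    then show "F (x + y) = F x + F y"
      by (simp add: lookup_add scaleR_add_left sum.distrib)
  next
    fix c and x :: multivector
    show "F (c *\<^sub>R x) = c *\<^sub>R F x"
      using keys_scaleR_subset[of c x]
      by (simp add: super[of "Poly_Mapping.keys x"] scaleR_sum_right)
  qed
qed

lemma linear_lookup: "linear (\<lambda>x::multivector. Poly_Mapping.lookup x A)"
  by (rule linearI) (simp_all add: lookup_add)

lemma lookup_grade_part: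
  "Poly_Mapping.lookup (grade_part k x) A = (if card A = k then Poly_Mapping.lookup x A else 0)"
  by (simp add: grade_part_def lookup_sum lookup_single when_def in_keys_iff)

lemma linear_grade_part: "linear (grade_part k)"
  by (rule linearI; rule poly_mapping_eqI) (simp_all add: lookup_grade_part lookup_add)

lemma grade_part_single:
  "grade_part k (Poly_Mapping.single A a) = (if card A = k then Poly_Mapping.single A a else 0)"
  by (rule poly_mapping_eqI) (auto simp: lookup_grade_part lookup_single when_def)

lemma wedge_list_increasing:
  assumes "sorted_wrt (<) is"
  shows "wedge_list (map dual_vec is) = Poly_Mapping.single (set is) 1"
  using diag_prod_increasing[OF assms] by (simp add: wedge_list_def wedge_def dual_vec_def[abs_def])

text \<open>Clifford and exterior basis elements share their index sets, and a sorted wedge list is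
  the blade itself. Finiteness of \<open>I\<close> matters because \<open>sorted_list_of_set\<close>
  enumerates only finite sets.\<close>

lemma symbol_map_eq:
  assumes "finite I" "x \<in> supported I"
  shows "symbol_map x = x"
proof -
  have "symbol_map x = id x"
  proof (rule linear_eq_on_supported[OF _ linear_id assms(2)])
    show "linear symbol_map"
      unfolding symbol_map_def[abs_def] by (rule linear_keys_sum)
    fix A assume "A \<subseteq> I"
    then have "finite A"
      using assms(1) by (rule finite_subset)
    then show "symbol_map (Poly_Mapping.single A 1) = id (Poly_Mapping.single A 1)"
      by (simp add: symbol_map_def wedge_list_increasing)
  qed
  then show ?thesis by simp
qed

lemma linear_relabel: "linear (relabel \<iota>)"
  unfolding relabel_def[abs_def] by (rule linear_keys_sum)

text \<open>An increasing relabelling keeps the list of generators sorted, hence produces no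
  sign.\<close>

lemma relabel_single_mono:
  assumes "strict_mono \<iota>" "finite A"
  shows "relabel \<iota> (Poly_Mapping.single A 1) = Poly_Mapping.single (\<iota> ` A) 1"
proof -
  have "sorted_wrt (<) (map \<iota> (sorted_list_of_set A))"
    unfolding sorted_wrt_map
    by (rule sorted_wrt_mono_rel[OF _ strict_sorted_list_of_set])
      (simp add: strict_monoD[OF assms(1)])
  from wedge_list_increasing[OF this] show ?thesis
    using assms(2) by (simp add: relabel_def comp_def)
qed

section \<open>Reordering signs\<close>

lemma reorder_sign_mult_self: "reorder_sign A B * reorder_sign A B = 1"
  by (simp add: reorder_sign_def flip: power_add mult_2)

text \<open>The pairs in \<open>A \<times> B\<close> split into those with \<open>b < a\<close>,
  with \<open>a < b\<close> and with \<open>a = b\<close>. The first two classes count the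
  inversions of the two orders of multiplication, and the third is a copy of
  \<open>A \<inter> B\<close>.\<close>

lemma reorder_sign_swap:
  assumes "finite A" "finite B"
  shows "reorder_sign A B = (- 1) ^ (card A * card B + card (A \<inter> B)) * reorder_sign B A"
proof -
  let ?L = "{(a, b). a \<in> A \<and> b \<in> B \<and> b < a}" and ?G = "{(a, b). a \<in> A \<and> b \<in> B \<and> a < b}"
    and ?E = "{(a, b). a \<in> A \<and> b \<in> B \<and> a = b}"
  have fin: "finite ?L" "finite ?G" "finite ?E"
    by (rule finite_subset[of _ "A \<times> B"]; use assms in auto)+
  have "card A * card B = card (?L \<union> ?G \<union> ?E)"
    by (subst card_cartesian_product[symmetric], rule arg_cong[where f = card]) auto
  also have "\<dots> = card ?L + card ?G + card ?E"
    using fin by (subst card_Un_disjoint; (subst card_Un_disjoint)?) auto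
  also have "card ?E = card (A \<inter> B)"
    by (rule bij_betw_same_card[of fst]) (auto simp: bij_betw_def inj_on_def image_iff)
  also have "card ?G = card {(b, a). b \<in> B \<and> a \<in> A \<and> a < b}"
    by (rule bij_betw_same_card[of prod.swap]) (auto simp: bij_betw_def inj_on_def image_iff)
  finally show ?thesis
    by (simp add: reorder_sign_def power_add flip: power_mult_distrib)
qed

lemma reorder_sign_image:
  assumes "strict_mono \<iota>"
  shows "reorder_sign (\<iota> ` A) (\<iota> ` B) = reorder_sign A B"
proof -
  have "bij_betw (map_prod \<iota> \<iota>) {(a, b). a \<in> A \<and> b \<in> B \<and> b < a}
      {(a, b). a \<in> \<iota> ` A \<and> b \<in> \<iota> ` B \<and> b < a}"
    using strict_mono_less[OF assms] strict_mono_eq[OF assms]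
    by (auto simp: bij_betw_def inj_on_def image_iff)
  from bij_betw_same_card[OF this] show ?thesis
    by (simp add: reorder_sign_def)
qed

lemma diag_prod_single_swap:
  assumes "finite A" "finite B"
  shows "diag_prod Q (Poly_Mapping.single A a) (Poly_Mapping.single B b) =
    (- 1) ^ (card A * card B + card (A \<inter> B)) *\<^sub>R
      diag_prod Q (Poly_Mapping.single B b) (Poly_Mapping.single A a)"
proof -
  have "sym_diff A B = sym_diff B A" "A \<inter> B = B \<inter> A"
    by auto
  then show ?thesis
    by (simp only: diag_prod_single reorder_sign_swap[OF assms] flip: single_eq_scaleR)
      (simp only: mult_ac)
qed

section \<open>Primitive idempotents by minimal dimension\<close>

text \<open>A vector of \<open>V\<close> outside \<open>U\<close> extends a basis of
  \<open>U\<close> to a larger independent set in \<open>V\<close>. The ambient space may be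
  infinite-dimensional; the finite set \<open>T\<close> bounds the bases.\<close>

lemma finite_span_subspace_dim_less:
  fixes U V :: "'a::real_vector set"
  assumes "finite T" "V \<subseteq> span T" "subspace U" "subspace V" "U \<subset> V"
  shows "dim U < dim V"
proof -
  obtain B where B: "B \<subseteq> U" "independent B" "U \<subseteq> span B" "card B = dim U"
    by (rule basis_exists)
  obtain C where C: "C \<subseteq> V" "independent C" "V \<subseteq> span C" "card C = dim V"
    by (rule basis_exists)
  have "finite C"
    using independent_span_bound[OF assms(1) C(2)] C(1) assms(2) by auto
  obtain v where v: "v \<in> V" "v \<notin> U"
    using assms(5) by auto
  have "v \<notin> span B"
    using v B(1) span_minimal[OF B(1) assms(3)] by auto
  then have "independent (insert v B)"
    using B(2) by (simp add: independent_insertI)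
  moreover have "insert v B \<subseteq> span C"
    using v(1) B(1) C(3) assms(5) by blast
  ultimately have "finite (insert v B) \<and> card (insert v B) \<le> card C"
    by (rule independent_span_bound[OF \<open>finite C\<close>])
  moreover have "v \<notin> B"
    using B(1) v(2) by auto
  ultimately show ?thesis
    using B(4) C(4) by auto
qed

text \<open>Among the nonzero idempotents, take \<open>e\<close> with the right ideal
  \<open>?ideal e\<close> of least dimension. A splitting \<open>e = a + b\<close> would give the
  strictly smaller ideal \<open>?ideal a\<close>, which misses \<open>b\<close>.\<close>

lemma exists_primitive_idempotent:
  assumes "finite I"
  obtains e where "e \<in> supported I" "e \<noteq> 0" "idempotent p e"
    "\<And>a b. a \<in> supported I \<Longrightarrow> b \<in> supported I \<Longrightarrow> a \<noteq> 0 \<Longrightarrow> b \<noteq> 0 \<Longrightarrow>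
      idempotent p a \<Longrightarrow> idempotent p b \<Longrightarrow> clifford_mult p a b = 0 \<Longrightarrow>
      clifford_mult p b a = 0 \<Longrightarrow> e \<noteq> a + b"
proof -
  let ?R = "supported I" and ?ideal = "\<lambda>e. clifford_mult p e ` supported I"
  let ?P = "\<lambda>e. e \<in> ?R \<and> e \<noteq> 0 \<and> idempotent p e"
  have "Poly_Mapping.lookup mv_one {} = (1::real)"
    by (simp add: mv_one_def)
  then have "mv_one \<noteq> 0"
    by auto
  then have "?P mv_one"
    by (simp add: mv_one_in_supported idempotent_def clifford_mult_one_left)
  then obtain e where e: "?P e" and least: "\<And>a. ?P a \<Longrightarrow> dim (?ideal e) \<le> dim (?ideal a)"
    using ex_has_least_nat[of ?P mv_one "\<lambda>e. dim (?ideal e)"] by auto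
  show thesis
  proof (rule that[of e])
    fix a b assume a: "a \<in> ?R" "a \<noteq> 0" "idempotent p a" and b: "b \<in> ?R" "b \<noteq> 0" "idempotent p b"
      and orth: "clifford_mult p a b = 0" "clifford_mult p b a = 0"
    show "e \<noteq> a + b"
    proof
      assume sum: "e = a + b"
      have ea: "clifford_mult p e a = a" and eb: "clifford_mult p e b = b"
        using a(3) b(3) orth by (simp_all add: sum clifford_mult_simps idempotent_def)
      have "?ideal a \<subseteq> ?ideal e"
      proof (rule image_subsetI)
        fix x assume x: "x \<in> ?R"
        have "clifford_mult p (clifford_mult p e a) x = clifford_mult p e (clifford_mult p a x)"
          by (rule clifford_mult_assoc[OF assms]) (use e a(1) x in auto)
        then have "clifford_mult p a x = clifford_mult p e (clifford_mult p a x)"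
          by (simp only: ea)
        then show "clifford_mult p a x \<in> ?ideal e"
          using clifford_mult_in_supported[OF a(1) x] by blast
      qed
      moreover have "b \<in> ?ideal e"
        using eb b(1) by (metis image_eqI)
      \<comment> \<open>Left multiplication by \<open>a\<close> fixes every element of
        \<open>?ideal a\<close>, but sends \<open>b\<close> to \<open>0\<close>.\<close>
      moreover have "b \<notin> ?ideal a"
      proof
        assume "b \<in> ?ideal a"
        then obtain x where x: "x \<in> ?R" "b = clifford_mult p a x"
          by auto
        have "clifford_mult p (clifford_mult p a a) x = clifford_mult p a (clifford_mult p a x)"
          by (rule clifford_mult_assoc[OF assms]) (use a(1) x(1) in auto)
        then have "clifford_mult p a b = b"
          using a(3) by (simp only: x(2) idempotent_def)
        with orth(1) b(2) show False by simp
      qed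
      ultimately have "?ideal a \<subset> ?ideal e"
        by blast
      moreover have "subspace (?ideal c)" for c
        by (rule linear_subspace_image[OF linear_clifford_mult_right subspace_supported])
      moreover have "?ideal e \<subseteq> span ((\<lambda>A. Poly_Mapping.single A 1) ` Pow I)"
        unfolding supported_eq_span[symmetric] using e by (auto intro: clifford_mult_in_supported)
      ultimately have "dim (?ideal a) < dim (?ideal e)"
        using assms by (intro finite_span_subspace_dim_less) auto
      with least[of a] a show False by simp
    qed
  qed (use e in auto)
qed

section \<open>Products of paired generators\<close>

declare One_nat_def [simp del]

definition pairs :: "nat \<Rightarrow> nat set \<Rightarrow> nat set" where
  "pairs p S = S \<union> (+) p ` S"

text \<open>The sign sorts the product of the commuting bivectors \<open>e\<^sub>i e\<^sub>p\<^sub>+\<^sub>i\<close> over \<open>i \<in> S\<close>.\<close>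

definition pair_blade :: "nat \<Rightarrow> nat set \<Rightarrow> multivector" where
  "pair_blade p S = Poly_Mapping.single (pairs p S) ((- 1) ^ (card S choose 2))"

lemma pairs_empty [simp]: "pairs p {} = {}"
  by (simp add: pairs_def)

lemma pairs_insert: "pairs p (insert i S) = {i, p + i} \<union> pairs p S"
  by (auto simp: pairs_def)

lemma pairs_mono: "S \<subseteq> T \<Longrightarrow> pairs p S \<subseteq> pairs p T"
  by (auto simp: pairs_def)

lemma finite_pairs: "finite S \<Longrightarrow> finite (pairs p S)"
  by (simp add: pairs_def)

lemma pair_blade_empty: "pair_blade p {} = mv_one"
  by (simp add: pair_blade_def mv_one_def binomial_eq_0)

lemma pairs_disjoint:
  fixes p :: nat
  assumes "S \<subseteq> {1..p}"
  shows "S \<inter> (+) p ` S = {}"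
proof (rule ccontr)
  assume "S \<inter> (+) p ` S \<noteq> {}"
  then obtain j where "j \<in> S" "p + j \<in> S"
    by auto
  with assms have "j \<in> {1..p}" "p + j \<in> {1..p}"
    by blast+
  then show False by simp
qed

lemma card_pairs:
  assumes "S \<subseteq> {1..p}"
  shows "card (pairs p S) = 2 * card S"
proof -
  have "finite S"
    using assms by (rule finite_subset) simp
  then show ?thesis
    using pairs_disjoint[OF assms] unfolding pairs_def
    by (subst card_Un_disjoint) (auto simp: card_image)
qed

lemma pair_inter_pairs:
  assumes "S \<subseteq> {1..p}" "i \<in> {1..p}"
  shows "{i, p + i} \<inter> pairs p S = (if i \<in> S then {i, p + i} else {})"
proof -
  have "p + i \<notin> S" "i \<notin> (+) p ` S"
    using assms subsetD[OF assms(1)] by fastforce+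
  then show ?thesis
    by (auto simp: pairs_def)
qed

text \<open>The sign factors into four blocks. The block of \<open>i\<close> against
  \<open>S\<close> and that of \<open>p + i\<close> against the shifted \<open>S\<close> are equal
  and cancel; \<open>i\<close> precedes every shifted index; \<open>p + i\<close> exceeds all
  elements of \<open>S\<close> and yields the remaining sign.\<close>

lemma reorder_sign_pair:
  assumes "S \<subseteq> {1..p}" "i \<in> {1..p}"
  shows "reorder_sign {i, p + i} (pairs p S) = (- 1) ^ card S"
proof -
  have fin: "finite S"
    using assms by (rule_tac finite_subset) auto
  have 1: "sym_diff {i} {p + i} = {i, p + i}"
    using assms by auto
  have 2: "sym_diff S ((+) p ` S) = pairs p S"
    using pairs_disjoint[OF assms(1)] by (auto simp: pairs_def)
  have "reorder_sign {p + i} S = (- 1) ^ card S"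
  proof -
    have "{(a, b). a \<in> {p + i} \<and> b \<in> S \<and> b < a} = Pair (p + i) ` S"
      using assms by fastforce
    then show ?thesis
      by (simp add: reorder_sign_def card_image inj_on_def)
  qed
  moreover have "reorder_sign {i} ((+) p ` S) = 1"
    using assms by (intro reorder_sign_increasing) auto
  moreover have "reorder_sign {p + i} ((+) p ` S) = reorder_sign {i} S"
    using reorder_sign_image[of "(+) p" "{i}" S] by (simp add: strict_mono_def)
  moreover have "reorder_sign {i, p + i} (pairs p S) =
      (reorder_sign {i} S * reorder_sign {i} ((+) p ` S)) *
      (reorder_sign {p + i} S * reorder_sign {p + i} ((+) p ` S))"
    unfolding 1[symmetric] 2[symmetric] using fin
    by (subst reorder_sign_sym_diff_left) (simp_all add: reorder_sign_sym_diff_right)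
  ultimately show ?thesis
    using reorder_sign_mult_self[of "{i}" S] by simp
qed

text \<open>The reordering sign matches the recursion for \<open>card S choose 2\<close>, so the
  normalised blades multiply without signs. No generator is repeated, hence any \<open>Q\<close> is
  allowed, and the result serves both products.\<close>

lemma diag_prod_pair_blade:
  assumes "S \<subseteq> {1..p}" "i \<in> {1..p}" "i \<notin> S"
  shows "diag_prod Q (Poly_Mapping.single {i, p + i} 1) (pair_blade p S) = pair_blade p (insert i S)"
proof -
  have fin: "finite S"
    using assms by (rule_tac finite_subset) auto
  have disj: "{i, p + i} \<inter> pairs p S = {}"
    using pair_inter_pairs[OF assms(1,2)] assms(3) by simp
  then have "sym_diff {i, p + i} (pairs p S) = pairs p (insert i S)"
    unfolding pairs_insert by blast
  moreover have "Suc (card S) choose 2 = card S + (card S choose 2)"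
    by (simp add: numeral_2_eq_2)
  ultimately show ?thesis
    using assms fin
    by (simp add: pair_blade_def diag_prod_single disj reorder_sign_pair power_add mult.commute)
qed

lemma wedge_pair_blade_self:
  assumes "i \<in> S"
  shows "Poly_Mapping.single {i, p + i} 1 \<and>\<^sub>\<Lambda> pair_blade p S = 0"
proof -
  have "i \<in> {i, p + i} \<inter> pairs p S"
    using assms by (auto simp: pairs_def)
  moreover have "finite ({i, p + i} \<inter> pairs p S)"
    by simp
  ultimately have "(\<Prod>i\<in>{i, p + i} \<inter> pairs p S. 0::real) = 0"
    by (metis prod_zero)
  then show ?thesis
    by (simp only: wedge_def pair_blade_def diag_prod_single mult_zero_right single_zero)
qed

text \<open>One more factor adds an index \<open>i\<close> to a set \<open>S\<close> of size
  \<open>k\<close>, and terms with \<open>i \<in> S\<close> vanish. Each set of size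
  \<open>Suc k\<close> arises once for each of its elements, which turns \<open>fact k\<close> into
  \<open>fact (Suc k)\<close>.\<close>

lemma wedge_power_pairs:
  assumes "I \<subseteq> {1..p}"
  shows "wedge_power (\<Sum>i\<in>I. Poly_Mapping.single {i, p + i} 1) k =
    fact k *\<^sub>R (\<Sum>S | S \<subseteq> I \<and> card S = k. pair_blade p S)"
proof (induction k)
  case 0
  have fin: "finite I"
    using assms by (rule finite_subset) simp
  have "{S. S \<subseteq> I \<and> card S = 0} = {{}}"
    using fin finite_subset by fastforce
  then show ?case
    by (simp add: wedge_power_def pair_blade_empty)
next
  case (Suc k)
  let ?u = "\<lambda>i. Poly_Mapping.single {i, p + i} 1 :: multivector"
  let ?C = "\<lambda>k. {S. S \<subseteq> I \<and> card S = k}"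
  have fin: "finite I"
    using assms by (rule finite_subset) simp
  then have finC: "finite (?C k)" for k
    by simp
  have finS: "finite S" if "S \<subseteq> I" for S
    using that fin by (rule finite_subset)
  have "(\<Sum>i\<in>I. ?u i) \<and>\<^sub>\<Lambda> (\<Sum>S\<in>?C k. pair_blade p S) =
      (\<Sum>S\<in>?C k. \<Sum>i\<in>I. ?u i \<and>\<^sub>\<Lambda> pair_blade p S)"
    unfolding wedge_def by (simp only: linear_sum[OF linear_diag_prod_left]
        linear_sum[OF linear_diag_prod_right])
  also have "\<dots> = (\<Sum>S\<in>?C k. \<Sum>i\<in>I - S. ?u i \<and>\<^sub>\<Lambda> pair_blade p S)"
    by (rule sum.cong[OF refl], rule sum.mono_neutral_right[OF fin])
      (auto simp: wedge_pair_blade_self)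
  also have "\<dots> = (\<Sum>S\<in>?C k. \<Sum>i\<in>I - S. pair_blade p (insert i S))"
    unfolding wedge_def
    by (rule sum.cong[OF refl], rule sum.cong[OF refl], rule diag_prod_pair_blade)
      (use assms in auto)
  also have "\<dots> = (\<Sum>(S, i)\<in>Sigma (?C k) (\<lambda>S. I - S). pair_blade p (insert i S))"
    by (rule sum.Sigma) (use fin in auto)
  also have "\<dots> = (\<Sum>(T, i)\<in>Sigma (?C (Suc k)) (\<lambda>T. T). pair_blade p T)"
    by (rule sum.reindex_bij_witness[where i = "\<lambda>(T, i). (T - {i}, i)"
          and j = "\<lambda>(S, i). (insert i S, i)"])
      (auto simp: insert_absorb finS card_Diff_singleton)
  also have "\<dots> = (\<Sum>T\<in>?C (Suc k). \<Sum>i\<in>T. pair_blade p T)"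
    by (rule sum.Sigma[symmetric]) (use finC finS in auto)
  also have "\<dots> = (\<Sum>T\<in>?C (Suc k). real (Suc k) *\<^sub>R pair_blade p T)"
  proof (rule sum.cong[OF refl])
    fix T assume "T \<in> ?C (Suc k)"
    then show "(\<Sum>i\<in>T. pair_blade p T) = real (Suc k) *\<^sub>R pair_blade p T"
      by (simp only: sum_constant_scaleR mem_Collect_eq)
  qed
  also have "\<dots> = real (Suc k) *\<^sub>R (\<Sum>T\<in>?C (Suc k). pair_blade p T)"
    by (simp only: scaleR_sum_right)
  finally have step: "(\<Sum>i\<in>I. ?u i) \<and>\<^sub>\<Lambda> (\<Sum>S\<in>?C k. pair_blade p S) = \<dots>" .
  have "wedge_power (\<Sum>i\<in>I. ?u i) (Suc k) = (\<Sum>i\<in>I. ?u i) \<and>\<^sub>\<Lambda> wedge_power (\<Sum>i\<in>I. ?u i) k"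
    by (simp add: wedge_power_def)
  also have "\<dots> = fact k *\<^sub>R ((\<Sum>i\<in>I. ?u i) \<and>\<^sub>\<Lambda> (\<Sum>S\<in>?C k. pair_blade p S))"
    unfolding Suc.IH by (simp only: wedge_def diag_prod_scaleR_right)
  also have "\<dots> = fact (Suc k) *\<^sub>R (\<Sum>S\<in>?C (Suc k). pair_blade p S)"
    unfolding step by (simp add: mult.commute)
  finally show ?case .
qed

text \<open>The product of the idempotents attached to the single pairs, already multiplied out:
  \<open>S\<close> records the factors from which the bivector, rather than \<open>1\<close>, is
  taken.\<close>

definition pair_idempotent :: "nat \<Rightarrow> nat \<Rightarrow> multivector" where
  "pair_idempotent p m = (1 / 2 ^ m) *\<^sub>R (\<Sum>S\<in>Pow {1..m}. pair_blade p S)"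

text \<open>The factorials cancel against \<open>wedge_power_pairs\<close>, and the double sum runs
  over the subsets grouped by cardinality.\<close>

lemma PQ_pairs:
  assumes "m \<le> p"
  shows "PQ m (\<Sum>i=1..m. Poly_Mapping.single {i, p + i} 1) = pair_idempotent p m"
proof -
  have "(\<Sum>k=0..m. (1 / fact k) *\<^sub>R wedge_power (\<Sum>i=1..m. Poly_Mapping.single {i, p + i} 1) k) =
      (\<Sum>k=0..m. \<Sum>S | S \<in> Pow {1..m} \<and> card S = k. pair_blade p S)"
    using assms by (intro sum.cong refl) (simp add: wedge_power_pairs)
  also have "\<dots> = (\<Sum>S\<in>Pow {1..m}. pair_blade p S)"
    by (intro sum.group) (auto dest!: card_mono[rotated])
  finally show ?thesis
    by (simp add: PQ_def pair_idempotent_def)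
qed

lemma grade_part_pair_idempotent:
  assumes "m \<le> p"
  shows "grade_part 2 (pair_idempotent p m) =
    (1 / 2 ^ m) *\<^sub>R (\<Sum>i=1..m. Poly_Mapping.single {i, p + i} 1)"
proof -
  have "(\<Sum>S\<in>Pow {1..m}. grade_part 2 (pair_blade p S)) =
      (\<Sum>S\<in>Pow {1..m}. if card S = 1 then pair_blade p S else 0)"
  proof (intro sum.cong refl)
    fix S assume "S \<in> Pow {1..m}"
    with assms have "S \<subseteq> {1..p}"
      by auto
    from card_pairs[OF this] show
      "grade_part 2 (pair_blade p S) = (if card S = 1 then pair_blade p S else 0)"
      by (simp add: pair_blade_def grade_part_single)
  qed
  also have "\<dots> = (\<Sum>S | S \<in> Pow {1..m} \<and> card S = 1. pair_blade p S)"
    by (rule sum.inter_filter[symmetric]) simp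
  \<comment> \<open>The sum over singletons is read as a first wedge power, so that
    \<open>wedge_power_pairs\<close> evaluates it.\<close>
  also have "\<dots> = wedge_power (\<Sum>i=1..m. Poly_Mapping.single {i, p + i} 1) 1"
    using assms by (simp add: wedge_power_pairs)
  also have "\<dots> = (\<Sum>i=1..m. Poly_Mapping.single {i, p + i} 1)"
    by (simp add: wedge_power_def wedge_def diag_prod_one_right One_nat_def)
  finally show ?thesis
    by (simp only: pair_idempotent_def linear_cmul[OF linear_grade_part]
        linear_sum[OF linear_grade_part])
qed

section \<open>The corner of the paired idempotent\<close>

locale paired_generators =
  fixes p q m :: nat
  assumes m_le: "m \<le> p" "m \<le> q"
begin

abbreviation cl_mult (infixl "\<cdot>" 70) where "x \<cdot> y \<equiv> clifford_mult p x y"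

abbreviation bivec :: "nat \<Rightarrow> multivector" where "bivec i \<equiv> Poly_Mapping.single {i, p + i} 1"

abbreviation f :: multivector where "f \<equiv> pair_idempotent p m"

abbreviation R :: "multivector set" where "R \<equiv> supported ({1..p + q} - pairs p {1..m})"

section \<open>Membership and associativity in the Clifford algebra\<close>

lemma pairs_subset: "pairs p {1..m} \<subseteq> {1..p + q}"
  using m_le by (auto simp: pairs_def)

lemma subset_p: "S \<subseteq> {1..m} \<Longrightarrow> S \<subseteq> {1..p}"
  using m_le by auto

lemma pair_blade_in: "S \<subseteq> {1..m} \<Longrightarrow> pair_blade p S \<in> clifford p q"
  unfolding pair_blade_def multivectors_eq_supported
  by (intro single_in_supported order_trans[OF pairs_mono pairs_subset])

lemma bivec_in: "i \<in> {1..m} \<Longrightarrow> bivec i \<in> clifford p q"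
  unfolding multivectors_eq_supported using m_le by (intro single_in_supported) auto

lemma f_in_supported: "f \<in> supported (pairs p {1..m})"
  unfolding pair_idempotent_def pair_blade_def
  by (intro subspace_scale subspace_sum subspace_supported single_in_supported pairs_mono) auto

lemma f_in: "f \<in> clifford p q"
  using f_in_supported supported_mono[OF pairs_subset] by (auto simp: multivectors_eq_supported)

lemma R_in: "x \<in> R \<Longrightarrow> x \<in> clifford p q"
  using supported_mono[of "{1..p + q} - pairs p {1..m}" "{1..p + q}"]
  by (auto simp: multivectors_eq_supported)

lemma mult_in: "x \<in> clifford p q \<Longrightarrow> y \<in> clifford p q \<Longrightarrow> x \<cdot> y \<in> clifford p q"
  unfolding multivectors_eq_supported by (rule clifford_mult_in_supported)

lemma mult_assoc:
  "x \<in> clifford p q \<Longrightarrow> y \<in> clifford p q \<Longrightarrow> z \<in> clifford p q \<Longrightarrow> x \<cdot> y \<cdot> z = x \<cdot> (y \<cdot> z)"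
  unfolding multivectors_eq_supported by (rule clifford_mult_assoc[OF finite_atLeastAtMost])

text \<open>The generators \<open>i\<close> and \<open>p + i\<close> have squares of opposite sign,
  and the one inversion contributes a second minus sign.\<close>

lemma bivec_square:
  assumes "i \<in> {1..m}"
  shows "bivec i \<cdot> bivec i = mv_one"
proof -
  have "{(a, b). a \<in> {i, p + i} \<and> b \<in> {i, p + i} \<and> b < a} = {(p + i, i)}"
    using assms m_le by auto
  then have "reorder_sign {i, p + i} {i, p + i} = - 1"
    by (simp add: reorder_sign_def)
  then show ?thesis
    using assms m_le by (simp add: clifford_mult_def diag_prod_single mv_one_def)
qed

text \<open>As \<open>bivec i\<close> has even grade, only the overlap decides: it anticommutes with
  blades containing exactly one of its generators and commutes with all others.\<close>

lemma bivec_swap: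
  assumes "finite B" "i \<in> {1..m}"
  shows "bivec i \<cdot> Poly_Mapping.single B b =
    (- 1) ^ card ({i, p + i} \<inter> B) *\<^sub>R (Poly_Mapping.single B b \<cdot> bivec i)"
proof -
  have "card {i, p + i} = 2"
    using assms m_le by auto
  then show ?thesis
    using diag_prod_single_swap[of "{i, p + i}" B] assms(1)
    by (simp add: clifford_mult_def power_add power_mult)
qed

lemma bivec_mult_pair_blade:
  assumes "i \<in> {1..m}" "S \<subseteq> {1..m}"
  shows "bivec i \<cdot> pair_blade p S = pair_blade p (if i \<in> S then S - {i} else insert i S)"
proof (cases "i \<in> S")
  case True
  \<comment> \<open>When \<open>i \<in> S\<close>, a factor \<open>bivec i\<close> is split off the
    blade and then cancelled by \<open>bivec_square\<close>.\<close>
  have "bivec i \<cdot> pair_blade p (S - {i}) = pair_blade p (insert i (S - {i}))"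
    unfolding clifford_mult_def using assms subset_p[OF assms(2)] m_le
    by (intro diag_prod_pair_blade) auto
  then have "bivec i \<cdot> pair_blade p (S - {i}) = pair_blade p S"
    using True by (simp add: insert_absorb)
  moreover have "bivec i \<cdot> bivec i \<cdot> pair_blade p (S - {i}) =
      bivec i \<cdot> (bivec i \<cdot> pair_blade p (S - {i}))"
    using assms by (intro mult_assoc bivec_in pair_blade_in) auto
  ultimately show ?thesis
    using True assms by (simp add: bivec_square clifford_mult_one_left)
next
  case False
  then show ?thesis
    using assms m_le by (auto simp: clifford_mult_def intro!: diag_prod_pair_blade)
qed

text \<open>Toggling membership of \<open>i\<close> is an involution on the subsets of
  \<open>{1..m}\<close>, so multiplication by \<open>bivec i\<close> permutes the summands of
  \<open>f\<close>.\<close>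

lemma bivec_mult_f:
  assumes "i \<in> {1..m}"
  shows "bivec i \<cdot> f = f"
proof -
  have "(\<Sum>S\<in>Pow {1..m}. bivec i \<cdot> pair_blade p S) = (\<Sum>S\<in>Pow {1..m}. pair_blade p S)"
    by (rule sum.reindex_bij_witness[where i = "\<lambda>S. if i \<in> S then S - {i} else insert i S"
          and j = "\<lambda>S. if i \<in> S then S - {i} else insert i S"])
      (use assms in \<open>auto simp: bivec_mult_pair_blade\<close>)
  then show ?thesis
    by (simp only: pair_idempotent_def clifford_mult_simps linear_sum[OF linear_clifford_mult_right])
qed

text \<open>Each blade of \<open>f\<close> contains both or neither of the generators of
  \<open>bivec i\<close>, so the two elements commute.\<close>

lemma f_mult_bivec:
  assumes "i \<in> {1..m}"
  shows "f \<cdot> bivec i = f"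
proof -
  have "bivec i \<cdot> pair_blade p S = pair_blade p S \<cdot> bivec i" if "S \<in> Pow {1..m}" for S
  proof -
    have "finite (pairs p S)"
      using that by (auto intro: finite_pairs finite_subset)
    moreover have "(- 1) ^ card ({i, p + i} \<inter> pairs p S) = (1 :: real)"
      using pair_inter_pairs[of S p i] subset_p[of S] that assms m_le by simp
    ultimately show ?thesis
      by (simp add: pair_blade_def bivec_swap[OF _ assms])
  qed
  then have "bivec i \<cdot> f = f \<cdot> bivec i"
    by (simp add: pair_idempotent_def clifford_mult_simps linear_sum[OF linear_clifford_mult_right]
        linear_sum[OF linear_clifford_mult_left])
  with bivec_mult_f[OF assms] show ?thesis by simp
qed

lemma f_mult_pair_blade:
  assumes "S \<subseteq> {1..m}"
  shows "f \<cdot> pair_blade p S = f"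
proof -
  have "finite S"
    using assms by (rule finite_subset) simp
  then show ?thesis
    using assms
  proof (induction S)
    case empty
    then show ?case by (simp add: pair_blade_empty clifford_mult_one_right)
  next
    case (insert i S)
    then have "pair_blade p (insert i S) = bivec i \<cdot> pair_blade p S"
      by (simp add: bivec_mult_pair_blade)
    moreover have "f \<cdot> bivec i \<cdot> pair_blade p S = f \<cdot> (bivec i \<cdot> pair_blade p S)"
      using insert.prems by (intro mult_assoc f_in bivec_in pair_blade_in) auto
    ultimately show ?case
      using insert by (simp add: f_mult_bivec)
  qed
qed

text \<open>The left factor \<open>f\<close> absorbs each of the \<open>2 ^ m\<close> blades of the
  right factor, and the normalisation cancels their number.\<close>

lemma f_idem: "f \<cdot> f = f"
proof -
  have "f \<cdot> f = (1 / 2 ^ m) *\<^sub>R (\<Sum>S\<in>Pow {1..m}. f \<cdot> pair_blade p S)"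
    by (subst (2) pair_idempotent_def)
      (simp only: clifford_mult_simps linear_sum[OF linear_clifford_mult_right])
  also have "\<dots> = (1 / 2 ^ m) *\<^sub>R (\<Sum>S\<in>Pow {1..m}. f)"
    by (simp add: f_mult_pair_blade)
  also have "\<dots> = f"
    by (simp add: sum_constant_scaleR card_Pow del: sum_constant)
  finally show ?thesis .
qed

text \<open>The blades of \<open>f\<close> have even size and share no generator with
  \<open>R\<close>, so every swap has sign \<open>1\<close>.\<close>

lemma f_commute:
  assumes "y \<in> R"
  shows "f \<cdot> y = y \<cdot> f"
proof (rule linear_eq_on_supported[OF linear_clifford_mult_right linear_clifford_mult_left assms])
  fix B assume B: "B \<subseteq> {1..p + q} - pairs p {1..m}"
  have "pair_blade p S \<cdot> Poly_Mapping.single B 1 = Poly_Mapping.single B 1 \<cdot> pair_blade p S"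
    if "S \<in> Pow {1..m}" for S
  proof -
    have "finite (pairs p S)" "finite B"
      using that B by (auto intro: finite_pairs finite_subset)
    moreover have "pairs p S \<inter> B = {}"
      using B pairs_mono[of S "{1..m}" p] that by blast
    moreover have "card (pairs p S) = 2 * card S"
      using that subset_p by (intro card_pairs) blast
    ultimately show ?thesis
      by (simp add: pair_blade_def clifford_mult_def diag_prod_single_swap[of "pairs p S" B]
          power_mult)
  qed
  then show "f \<cdot> Poly_Mapping.single B 1 = Poly_Mapping.single B 1 \<cdot> f"
    by (simp add: pair_idempotent_def clifford_mult_simps linear_sum[OF linear_clifford_mult_right]
        linear_sum[OF linear_clifford_mult_left])
qed

text \<open>
  Because \<open>bivec i\<close> is absorbed by \<open>f\<close> on both sides, a blade that contains exactly one of the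
  generators \<open>i\<close>, \<open>p + i\<close>, and hence anticommutes with \<open>bivec i\<close>, is annihilated.
\<close>

lemma corner_blade:
  assumes "A \<subseteq> {1..p + q}"
  shows "\<exists>y\<in>R. f \<cdot> Poly_Mapping.single A 1 \<cdot> f = f \<cdot> y"
  using assms
proof (induction "card A" arbitrary: A rule: less_induct)
  case less
  let ?e = "\<lambda>A. Poly_Mapping.single A 1 :: multivector"
  have fin: "finite A"
    using less.prems by (rule finite_subset) simp
  have in_cl: "?e B \<in> clifford p q" if "B \<subseteq> A" for B
    unfolding multivectors_eq_supported using that less.prems by (intro single_in_supported) auto
  show ?case
  proof (cases "A \<inter> pairs p {1..m} = {}")
    case True
    \<comment> \<open>A blade without paired generators lies in \<open>R\<close> and commutes with
      \<open>f\<close>, so the two copies of \<open>f\<close> merge.\<close>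
    then have R: "?e A \<in> R"
      using less.prems by (intro single_in_supported) auto
    have "f \<cdot> ?e A \<cdot> f = f \<cdot> (?e A \<cdot> f)"
      by (intro mult_assoc f_in in_cl subset_refl)
    also have "\<dots> = f \<cdot> (f \<cdot> ?e A)"
      by (simp only: f_commute[OF R])
    also have "\<dots> = f \<cdot> f \<cdot> ?e A"
      by (intro mult_assoc[symmetric] f_in in_cl subset_refl)
    also have "\<dots> = f \<cdot> ?e A"
      by (simp only: f_idem)
    finally show ?thesis
      using R by blast
  next
    case False
    then have "\<exists>i\<in>{1..m}. i \<in> A \<or> p + i \<in> A"
      unfolding pairs_def by blast
    then obtain i where i: "i \<in> {1..m}" "{i, p + i} \<inter> A \<noteq> {}"
      by blast
    note bi = bivec_in[OF i(1)]
    show ?thesis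
    proof (cases "{i, p + i} \<subseteq> A")
      case True
      \<comment> \<open>A full pair splits off as \<open>bivec i\<close> up to the sign
        \<open>c\<close> and is absorbed by \<open>f\<close>; induction applies to the shorter blade
        \<open>?B\<close>.\<close>
      let ?B = "A - {i, p + i}"
      define c where "c = reorder_sign {i, p + i} ?B"
      have "{i, p + i} \<inter> ?B = {}" "sym_diff {i, p + i} ?B = A"
        using True by auto
      then have "bivec i \<cdot> ?e ?B = c *\<^sub>R ?e A"
        by (simp add: clifford_mult_def diag_prod_single c_def flip: single_eq_scaleR)
      moreover have "c * c = 1"
        by (simp add: c_def reorder_sign_mult_self)
      ultimately have A: "?e A = c *\<^sub>R (bivec i \<cdot> ?e ?B)"
        by simp
      have "f \<cdot> ?e A \<cdot> f = c *\<^sub>R (f \<cdot> (bivec i \<cdot> ?e ?B) \<cdot> f)"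
        by (simp only: A clifford_mult_simps)
      also have "f \<cdot> (bivec i \<cdot> ?e ?B) = f \<cdot> ?e ?B"
        using mult_assoc[OF f_in bi in_cl[of ?B]] by (simp add: f_mult_bivec[OF i(1)])
      finally have *: "f \<cdot> ?e A \<cdot> f = c *\<^sub>R (f \<cdot> ?e ?B \<cdot> f)" .
      have "card ?B < card A"
        using True fin by (intro psubset_card_mono) auto
      then obtain y where "y \<in> R" "f \<cdot> ?e ?B \<cdot> f = f \<cdot> y"
        using less.hyps[of ?B] less.prems by blast
      then show ?thesis
        by (intro bexI[of _ "c *\<^sub>R y"])
          (simp_all only: * clifford_mult_simps subspace_scale[OF subspace_supported])
    next
      case False
      then have "{i, p + i} \<inter> A = {i} \<or> {i, p + i} \<inter> A = {p + i}"
        using i(2) by auto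
      then have "card ({i, p + i} \<inter> A) = 1"
        by auto
      then have anti: "bivec i \<cdot> ?e A = - (?e A \<cdot> bivec i)"
        using bivec_swap[OF fin i(1), of 1] by simp
      have "f \<cdot> ?e A \<cdot> f = f \<cdot> (bivec i \<cdot> ?e A) \<cdot> f"
        using mult_assoc[OF f_in bi in_cl[of A]] by (simp add: f_mult_bivec[OF i(1)])
      also have "\<dots> = - (f \<cdot> (?e A \<cdot> bivec i) \<cdot> f)"
        by (simp only: anti linear_neg[OF linear_clifford_mult_right]
            linear_neg[OF linear_clifford_mult_left])
      also have "f \<cdot> (?e A \<cdot> bivec i) \<cdot> f = f \<cdot> (?e A \<cdot> (bivec i \<cdot> f))"
        using f_in bi in_cl[of A] by (simp add: mult_assoc mult_in)
      also have "\<dots> = f \<cdot> ?e A \<cdot> f"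
        using f_in in_cl[of A] by (simp add: mult_assoc bivec_mult_f[OF i(1)])
      finally have "2 *\<^sub>R (f \<cdot> ?e A \<cdot> f) = 0"
        by (simp add: scaleR_2)
      then show ?thesis
        using subspace_0[OF subspace_supported]
        by (intro bexI[of _ 0]) (simp_all add: clifford_mult_simps)
    qed
  qed
qed

text \<open>Linear extension of \<open>corner_blade\<close>. With \<open>f_mult_cancel\<close> and
  \<open>f_mult_mult\<close> it identifies the corner with \<open>R\<close> through
  \<open>y \<mapsto> f \<cdot> y\<close>.\<close>

lemma corner:
  assumes "x \<in> clifford p q"
  obtains y where "y \<in> R" "f \<cdot> x \<cdot> f = f \<cdot> y"
proof -
  let ?V = "{x. \<exists>y\<in>R. f \<cdot> x \<cdot> f = f \<cdot> y}"
  have "subspace ?V"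
  proof (rule subspaceI)
    show "0 \<in> ?V"
      using subspace_0[OF subspace_supported]
      by (auto simp: clifford_mult_simps intro!: bexI[of _ 0])
  next
    fix x x' assume "x \<in> ?V" "x' \<in> ?V"
    then obtain y y' where "y \<in> R" "f \<cdot> x \<cdot> f = f \<cdot> y" "y' \<in> R" "f \<cdot> x' \<cdot> f = f \<cdot> y'"
      by auto
    then show "x + x' \<in> ?V"
      by (auto simp: clifford_mult_simps subspace_add[OF subspace_supported]
          intro!: bexI[of _ "y + y'"])
  next
    fix c x assume "x \<in> ?V"
    then obtain y where "y \<in> R" "f \<cdot> x \<cdot> f = f \<cdot> y"
      by auto
    then show "c *\<^sub>R x \<in> ?V"
      by (auto simp: clifford_mult_simps subspace_scale[OF subspace_supported]
          intro!: bexI[of _ "c *\<^sub>R y"])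
  qed
  then have "supported {1..p + q} \<subseteq> ?V"
    using corner_blade by (intro supported_subset_subspace) auto
  with assms that show thesis
    by (auto simp: multivectors_eq_supported)
qed

text \<open>In \<open>f \<cdot> y\<close>, every summand of \<open>f\<close> with
  \<open>S \<noteq> {}\<close> leaves some paired generator in each blade. Away from the pairs only
  the scalar part of \<open>f\<close> contributes, so \<open>f \<cdot> y\<close> determines
  \<open>y\<close>.\<close>

lemma lookup_f_mult:
  assumes "y \<in> R" "B \<inter> pairs p {1..m} = {}"
  shows "Poly_Mapping.lookup (f \<cdot> y) B = (1 / 2 ^ m) * Poly_Mapping.lookup y B"
proof (rule linear_eq_on_supported[OF _ _ assms(1)])
  show "linear (\<lambda>y. Poly_Mapping.lookup (f \<cdot> y) B)"
    by (rule linear_compose[OF linear_clifford_mult_right linear_lookup, unfolded comp_def])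
  show "linear (\<lambda>y::multivector. 1 / 2 ^ m * Poly_Mapping.lookup y B)"
    by (rule linearI) (simp_all add: lookup_add distrib_left)
next
  fix B' assume B': "B' \<subseteq> {1..p + q} - pairs p {1..m}"
  have "Poly_Mapping.lookup (pair_blade p S \<cdot> Poly_Mapping.single B' 1) B =
      (if S = {} then Poly_Mapping.lookup (Poly_Mapping.single B' 1) B else 0)"
    if "S \<in> Pow {1..m}" for S
  proof (cases "S = {}")
    case True
    then show ?thesis by (simp add: pair_blade_empty clifford_mult_one_left)
  next
    case False
    then obtain i where "i \<in> S"
      by blast
    with that have "i \<in> pairs p S" "i \<in> pairs p {1..m}"
      by (auto simp: pairs_def)
    then have "sym_diff (pairs p S) B' \<noteq> B"
      using B' assms(2) by auto
    then show ?thesis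
      using False by (simp add: pair_blade_def clifford_mult_def diag_prod_single lookup_single)
  qed
  then show "Poly_Mapping.lookup (f \<cdot> Poly_Mapping.single B' 1) B =
      1 / 2 ^ m * Poly_Mapping.lookup (Poly_Mapping.single B' 1) B"
    by (simp add: pair_idempotent_def clifford_mult_simps linear_sum[OF linear_clifford_mult_left]
        lookup_sum)
qed

lemma f_mult_cancel:
  assumes "x \<in> R" "y \<in> R" "f \<cdot> x = f \<cdot> y"
  shows "x = y"
proof (rule poly_mapping_eqI)
  fix B
  show "Poly_Mapping.lookup x B = Poly_Mapping.lookup y B"
  proof (cases "B \<inter> pairs p {1..m} = {}")
    case True
    then show ?thesis
      using lookup_f_mult[OF assms(1)] lookup_f_mult[OF assms(2)] assms(3) by simp
  next
    case False
    then have "B \<notin> Poly_Mapping.keys x" "B \<notin> Poly_Mapping.keys y"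
      using assms by (auto simp: supported_def)
    then show ?thesis by (simp add: in_keys_iff)
  qed
qed

lemma f_mult_mult:
  assumes "x \<in> R" "y \<in> R"
  shows "f \<cdot> x \<cdot> (f \<cdot> y) = f \<cdot> (x \<cdot> y)"
proof -
  note xy = R_in[OF assms(1)] R_in[OF assms(2)]
  have "f \<cdot> x \<cdot> (f \<cdot> y) = f \<cdot> (x \<cdot> f \<cdot> y)"
    using xy f_in by (simp add: mult_assoc mult_in)
  also have "x \<cdot> f \<cdot> y = f \<cdot> (x \<cdot> y)"
    unfolding f_commute[OF assms(1), symmetric] using xy f_in by (simp add: mult_assoc)
  also have "f \<cdot> (f \<cdot> (x \<cdot> y)) = f \<cdot> f \<cdot> (x \<cdot> y)"
    using xy f_in by (simp add: mult_assoc mult_in)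
  finally show ?thesis by (simp add: f_idem)
qed

text \<open>Both parts of an orthogonal splitting of \<open>f \<cdot> e\<close> lie in the corner of
  \<open>f\<close>. They come from elements of \<open>R\<close>, which then form a splitting of
  \<open>e\<close>.\<close>

lemma primitive_f_mult:
  assumes e: "e \<in> R" "e \<noteq> 0" "idempotent p e"
    and prim: "\<And>a b. a \<in> R \<Longrightarrow> b \<in> R \<Longrightarrow> a \<noteq> 0 \<Longrightarrow> b \<noteq> 0 \<Longrightarrow> idempotent p a \<Longrightarrow>
      idempotent p b \<Longrightarrow> a \<cdot> b = 0 \<Longrightarrow> b \<cdot> a = 0 \<Longrightarrow> e \<noteq> a + b"
  shows "primitive_idempotent p q (f \<cdot> e)"
proof -
  let ?h = "f \<cdot> e"
  have R0: "0 \<in> R"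
    by (rule subspace_0[OF subspace_supported])
  have e_in: "e \<in> clifford p q" and h_in: "?h \<in> clifford p q"
    using e(1) f_in by (simp_all add: R_in mult_in)
  have "?h \<noteq> 0"
    using f_mult_cancel[OF e(1) R0] e(2) by (auto simp: clifford_mult_simps)
  moreover have "idempotent p ?h"
    using f_mult_mult[OF e(1) e(1)] e(3) by (simp add: idempotent_def)
  moreover have False
    if a: "a \<in> clifford p q" "a \<noteq> 0" "idempotent p a"
      and b: "b \<in> clifford p q" "b \<noteq> 0" "idempotent p b"
      and ab: "a \<cdot> b = 0" "b \<cdot> a = 0" and h: "?h = a + b" for a b
  proof -
    have fh: "f \<cdot> ?h = ?h"
      using mult_assoc[OF f_in f_in e_in] unfolding f_idem by (rule sym)
    have hf: "?h \<cdot> f = ?h"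
      unfolding mult_assoc[OF f_in e_in f_in] f_commute[OF e(1), symmetric] by (rule fh)
    \<comment> \<open>What \<open>?h\<close> fixes from both sides is also fixed by \<open>f\<close>
      from both sides, because \<open>f\<close> fixes \<open>?h\<close>; then \<open>corner\<close>
      applies to \<open>x = f \<cdot> x \<cdot> f\<close>.\<close>
    have ex: "\<exists>x'\<in>R. x = f \<cdot> x'" if x: "x \<in> clifford p q" "?h \<cdot> x = x" "x \<cdot> ?h = x" for x
    proof -
      have "f \<cdot> x = x"
        using mult_assoc[OF f_in h_in x(1)] unfolding fh x(2) by (rule sym)
      moreover have "x \<cdot> f = x"
        using mult_assoc[OF x(1) h_in f_in] unfolding hf x(3) .
      moreover obtain y where "y \<in> R" "f \<cdot> x \<cdot> f = f \<cdot> y"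
        using corner[OF x(1)] .
      ultimately show ?thesis
        by auto
    qed
    have "?h \<cdot> a = a" "a \<cdot> ?h = a" "?h \<cdot> b = b" "b \<cdot> ?h = b"
      using a(3) b(3) ab by (simp_all only: h clifford_mult_simps idempotent_def add_0 add_0_right)
    then obtain a' b' where a': "a' \<in> R" "a = f \<cdot> a'" and b': "b' \<in> R" "b = f \<cdot> b'"
      using ex[OF a(1)] ex[OF b(1)] by blast
    note R_mult = clifford_mult_in_supported[where I = "{1..p + q} - pairs p {1..m}"]
    have "idempotent p a'" "idempotent p b'"
      using f_mult_cancel[OF R_mult[OF a'(1) a'(1)] a'(1)] a(3)
        f_mult_cancel[OF R_mult[OF b'(1) b'(1)] b'(1)] b(3)
      unfolding a'(2) b'(2) idempotent_def
      by (simp_all only: f_mult_mult[OF a'(1) a'(1)] f_mult_mult[OF b'(1) b'(1)])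
    moreover have "a' \<cdot> b' = 0"
      using f_mult_cancel[OF R_mult[OF a'(1) b'(1)] R0] ab(1) f_mult_mult[OF a'(1) b'(1)]
      by (simp add: a' b' clifford_mult_simps)
    moreover have "b' \<cdot> a' = 0"
      using f_mult_cancel[OF R_mult[OF b'(1) a'(1)] R0] ab(2) f_mult_mult[OF b'(1) a'(1)]
      by (simp add: a' b' clifford_mult_simps)
    moreover have "a' \<noteq> 0" "b' \<noteq> 0"
      using a(2) b(2) a'(2) b'(2) by (auto simp: clifford_mult_simps)
    moreover have "e = a' + b'"
    proof (rule f_mult_cancel[OF e(1) subspace_add[OF subspace_supported a'(1) b'(1)]])
      show "f \<cdot> e = f \<cdot> (a' + b')"
        by (simp only: h a'(2) b'(2) clifford_mult_simps)
    qed
    ultimately show False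
      using prim[OF a'(1) b'(1)] by blast
  qed
  ultimately show ?thesis
    unfolding primitive_idempotent_def using h_in by blast
qed

end

section \<open>Recovering the unitary structure\<close>

text \<open>An increasing relabelling preserves all inversions, and \<open>sgn\<close> makes the
  squares of corresponding generators agree.\<close>

lemma clifford_isomorphic_relabel:
  assumes \<iota>: "strict_mono \<iota>" and sgn: "\<And>i. i \<in> {1..r + s} \<Longrightarrow> \<iota> i \<le> p \<longleftrightarrow> i \<le> r"
  shows "clifford_isomorphic p (supported (\<iota> ` {1..r + s})) r (clifford r s)"
proof -
  let ?N = "{1..r + s}"
  have "inj \<iota>"
    using \<iota> by (rule strict_mono_imp_inj_on)
  then have inj: "inj (image \<iota>)"
    by (simp add: inj_image_eq_iff inj_def)
  \<comment> \<open>The map goes from the subalgebra to the standard algebra: the coefficient at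
    \<open>B\<close> is read off at the image of \<open>B\<close> under
    \<open>\<iota>\<close>.\<close>
  define \<phi> :: "multivector \<Rightarrow> multivector" where "\<phi> = Poly_Mapping.map_key (image \<iota>)"
  have lookup: "Poly_Mapping.lookup (\<phi> x) B = Poly_Mapping.lookup x (\<iota> ` B)" for x B
    by (simp add: \<phi>_def map_key.rep_eq[OF inj])
  have single: "\<phi> (Poly_Mapping.single (\<iota> ` B) c) = Poly_Mapping.single B c" for B c
    unfolding \<phi>_def by (rule map_key_single[OF inj])
  have lin: "linear \<phi>"
    by (rule linearI; rule poly_mapping_eqI) (simp_all add: lookup lookup_add)
  have "bij_betw \<phi> (supported (\<iota> ` ?N)) (supported ?N)"
    unfolding bij_betw_def
  proof
    show "inj_on \<phi> (supported (\<iota> ` ?N))"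
    proof (rule inj_onI, rule poly_mapping_eqI)
      fix x y A assume xy: "x \<in> supported (\<iota> ` ?N)" "y \<in> supported (\<iota> ` ?N)" "\<phi> x = \<phi> y"
      show "Poly_Mapping.lookup x A = Poly_Mapping.lookup y A"
      proof (cases "A \<subseteq> \<iota> ` ?N")
        case True
        then obtain B where "A = \<iota> ` B"
          by (auto simp: subset_image_iff)
        with xy(3) show ?thesis
          by (metis lookup)
      next
        case False
        with xy(1,2) have "A \<notin> Poly_Mapping.keys x" "A \<notin> Poly_Mapping.keys y"
          by (auto simp: supported_def)
        then show ?thesis by (simp add: in_keys_iff)
      qed
    qed
  next
    show "\<phi> ` supported (\<iota> ` ?N) = supported ?N"
    proof
      show "\<phi> ` supported (\<iota> ` ?N) \<subseteq> supported ?N"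
      proof (rule image_subsetI)
        fix x assume x: "x \<in> supported (\<iota> ` ?N)"
        have "A \<subseteq> ?N" if "A \<in> Poly_Mapping.keys (\<phi> x)" for A
        proof -
          from that have "\<iota> ` A \<in> Poly_Mapping.keys x"
            by (simp add: in_keys_iff lookup)
          moreover have "\<forall>B\<in>Poly_Mapping.keys x. B \<subseteq> \<iota> ` ?N"
            using x by (simp only: supported_def mem_Collect_eq)
          ultimately have "\<iota> ` A \<subseteq> \<iota> ` ?N"
            by (rule bspec[rotated])
          then show ?thesis
            by (simp only: inj_image_subset_iff[OF \<open>inj \<iota>\<close>])
        qed
        then show "\<phi> x \<in> supported ?N"
          by (simp add: supported_def)
      qed
      show "supported ?N \<subseteq> \<phi> ` supported (\<iota> ` ?N)"
      proof (rule supported_subset_subspace)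
        fix A assume "A \<subseteq> ?N"
        then have "\<phi> (Poly_Mapping.single (\<iota> ` A) 1) \<in> \<phi> ` supported (\<iota> ` ?N)"
          by (rule imageI[OF single_in_supported[OF image_mono]])
        then show "Poly_Mapping.single A 1 \<in> \<phi> ` supported (\<iota> ` ?N)"
          by (simp only: single)
      qed (rule linear_subspace_image[OF lin subspace_supported])
    qed
  qed
  moreover have "\<phi> mv_one = mv_one"
    using single[of "{}"] by (simp add: mv_one_def)
  moreover have "\<phi> (clifford_mult p x y) = clifford_mult r (\<phi> x) (\<phi> y)"
    if x: "x \<in> supported (\<iota> ` ?N)" and y: "y \<in> supported (\<iota> ` ?N)" for x y
  proof (rule linear_eq_on_supported[OF _ _ x])
    show "linear (\<lambda>x. \<phi> (clifford_mult p x y))"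
      by (rule linear_compose[OF linear_clifford_mult_left lin, unfolded comp_def])
    show "linear (\<lambda>x. clifford_mult r (\<phi> x) (\<phi> y))"
      by (rule linear_compose[OF lin linear_clifford_mult_left, unfolded comp_def])
  next
    fix A assume A: "A \<subseteq> \<iota> ` ?N"
    show "\<phi> (clifford_mult p (Poly_Mapping.single A 1) y) =
        clifford_mult r (\<phi> (Poly_Mapping.single A 1)) (\<phi> y)"
    proof (rule linear_eq_on_supported[OF _ _ y])
      show "linear (\<lambda>y. \<phi> (clifford_mult p (Poly_Mapping.single A 1) y))"
        by (rule linear_compose[OF linear_clifford_mult_right lin, unfolded comp_def])
      show "linear (\<lambda>y. clifford_mult r (\<phi> (Poly_Mapping.single A 1)) (\<phi> y))"
        by (rule linear_compose[OF lin linear_clifford_mult_right, unfolded comp_def])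
    next
      fix B assume B: "B \<subseteq> \<iota> ` ?N"
      obtain A' B' where A': "A' \<subseteq> ?N" "A = \<iota> ` A'" and B': "B' \<subseteq> ?N" "B = \<iota> ` B'"
        using A B by (auto simp: subset_image_iff)
      have "sym_diff A B = \<iota> ` sym_diff A' B'" "A \<inter> B = \<iota> ` (A' \<inter> B')"
        unfolding A' B' by (simp_all add: image_Un image_Int image_set_diff \<open>inj \<iota>\<close>)
      moreover have "(\<Prod>i\<in>\<iota> ` (A' \<inter> B'). if i \<le> p then 1 else - 1 :: real) =
          (\<Prod>i\<in>A' \<inter> B'. if i \<le> r then 1 else - 1)"
        using A'(1) sgn
        by (subst prod.reindex) (auto intro!: prod.cong inj_on_subset[OF \<open>inj \<iota>\<close>])
      moreover have "reorder_sign A B = reorder_sign A' B'"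
        unfolding A' B' by (rule reorder_sign_image[OF \<iota>])
      ultimately show "\<phi> (clifford_mult p (Poly_Mapping.single A 1) (Poly_Mapping.single B 1)) =
          clifford_mult r (\<phi> (Poly_Mapping.single A 1)) (\<phi> (Poly_Mapping.single B 1))"
        by (simp only: clifford_mult_def diag_prod_single single)
          (simp only: A'(2) B'(2) single diag_prod_single)
    qed
  qed
  ultimately show ?thesis
    unfolding clifford_isomorphic_def multivectors_eq_supported
    by (intro exI[of _ \<phi>] conjI) (simp_all add: linear_add[OF lin] linear_cmul[OF lin])
qed

section \<open>The Kahler form in the paired generators\<close>

lemma kahler_form_eq: "kahler_form m = (\<Sum>k=1..m. Poly_Mapping.single {k, m + k} 1)"
  unfolding kahler_form_def
proof (intro sum.cong refl)
  fix k assume "k \<in> {1..m}"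
  then have "reorder_sign {k} {m + k} = 1" "sym_diff {k} {m + k} = {k, m + k}" "m \<noteq> 0"
    by (auto intro!: reorder_sign_increasing)
  then show "dual_vec k \<and>\<^sub>\<Lambda> dual_vec (m + k) = Poly_Mapping.single {k, m + k} 1"
    by (simp add: wedge_def dual_vec_def diag_prod_single)
qed

text \<open>For \<open>m \<le> p\<close> the index \<open>m + k\<close> with
  \<open>1 \<le> k\<close> goes to \<open>p + k\<close>, the partner of \<open>k\<close>. The map
  increases on all of \<open>nat\<close>, so relabelling causes no signs.\<close>

definition pair_labels :: "nat \<Rightarrow> nat \<Rightarrow> nat \<Rightarrow> nat" where
  "pair_labels p m k = (if k \<le> m then k else k + (p - m))"

lemma strict_mono_pair_labels: "strict_mono (pair_labels p m)"
  by (auto simp: strict_mono_def pair_labels_def)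

lemma pair_labels_image:
  assumes "m \<le> p"
  shows "pair_labels p m ` {1..2 * m} = pairs p {1..m}"
proof -
  have "{1..2 * m} = {1..m} \<union> (+) m ` {1..m}"
    by (auto simp: image_iff intro: exI[of _ "_ - m"] dest: le_Suc_ex)
  moreover have "pair_labels p m ` {1..m} = {1..m}"
    by (auto simp: pair_labels_def)
  moreover have "pair_labels p m ` ((+) m ` {1..m}) = (+) p ` {1..m}"
    unfolding image_image using assms by (intro image_cong) (auto simp: pair_labels_def)
  ultimately show ?thesis
    by (simp add: pairs_def image_Un)
qed

lemma relabel_kahler_form:
  assumes "m \<le> p"
  shows "relabel (pair_labels p m) (kahler_form m) =
    (\<Sum>i=1..m. Poly_Mapping.single {i, p + i} 1)"
  unfolding kahler_form_eq linear_sum[OF linear_relabel]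
proof (intro sum.cong refl)
  fix i assume "i \<in> {1..m}"
  then have "pair_labels p m ` {i, m + i} = {i, p + i}"
    using assms by (auto simp: pair_labels_def)
  then show "relabel (pair_labels p m) (Poly_Mapping.single {i, m + i} 1) =
      Poly_Mapping.single {i, p + i} 1"
    by (simp only: relabel_single_mono[OF strict_mono_pair_labels] finite.emptyI finite.insertI)
qed

text \<open>Of the selected generators, \<open>m\<close> square to \<open>1\<close> and
  \<open>m\<close> to \<open>-1\<close>, so they generate a copy of the algebra of signature
  \<open>(m, m)\<close>.\<close>

lemma pair_idempotent_recovers:
  assumes "m \<le> p" "m \<le> q" "p \<noteq> q"
  shows "recovers_by_projection p q (2 * m) {kahler_form m} (pair_labels p m) (pair_idempotent p m)"
proof -
  interpret paired_generators p q m
    using assms by unfold_locales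
  let ?\<iota> = "pair_labels p m" and ?A = "supported (pairs p {1..m})"
  let ?\<omega> = "\<Sum>i=1..m. Poly_Mapping.single {i, p + i} 1 :: multivector"
  have A: "clifford_subalgebra p (clifford_gen ` ?\<iota> ` {1..2 * m}) = ?A"
    by (simp add: pair_labels_image[OF assms(1)] clifford_subalgebra_clifford_gen finite_pairs
        supported_def)
  have "clifford_isomorphic p (supported (?\<iota> ` {1..m + m})) m (clifford m m)"
    using assms(1) by (intro clifford_isomorphic_relabel strict_mono_pair_labels)
      (auto simp: pair_labels_def)
  then have "clifford_isomorphic p ?A m (clifford m m)"
    using pair_labels_image[OF assms(1)] by (simp add: mult_2)
  then have iso: "\<exists>r s. r + s = 2 * m \<and> clifford_isomorphic p ?A r (clifford r s)"
    by (intro exI[of _ m]) (simp add: mult_2)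
  \<comment> \<open>The scalar undoes the factor \<open>1 / 2 ^ m\<close> in the degree-two
    component of \<open>f\<close>.\<close>
  let ?\<psi> = "Times (Scalar (2 ^ m)) (Component 2)"
  have eval: "eval_expr p f ?\<psi> = ?\<omega>"
    by (simp add: clifford_mult_simps clifford_mult_one_left grade_part_pair_idempotent assms)
  have "?\<omega> \<in> ?A"
    by (intro subspace_sum[OF subspace_supported] single_in_supported) (auto simp: pairs_def)
  moreover have "symbol_map ?\<omega> = relabel ?\<iota> (kahler_form m)"
    using symbol_map_eq[OF finite_pairs \<open>?\<omega> \<in> ?A\<close>] assms(1) by (simp add: relabel_kahler_form)
  ultimately have "\<exists>\<psi>. eval_expr p f \<psi> \<in> ?A \<and> symbol_map (eval_expr p f \<psi>) = relabel ?\<iota> (kahler_form m)"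
    by (intro exI[of _ ?\<psi>]) (simp only: eval)
  moreover have "kahler_form m \<in> forms (2 * m)"
    unfolding kahler_form_eq multivectors_eq_supported
    by (intro subspace_sum[OF subspace_supported] single_in_supported) auto
  moreover have "inj_on ?\<iota> {1..2 * m}"
    by (rule strict_mono_imp_inj_on[OF strict_mono_pair_labels])
  \<comment> \<open>The strict bound \<open>2 * m < p + q\<close> follows from
    \<open>m \<le> p\<close>, \<open>m \<le> q\<close> and \<open>p \<noteq> q\<close>.\<close>
  ultimately show ?thesis
    unfolding recovers_by_projection_def Let_def A
    using assms iso f_in_supported pairs_subset by (auto simp: pair_labels_image)
qed

theorem proposition4p3:
  fixes p q m :: nat
  assumes "p \<noteq> q" and "p \<noteq> 0" and "q \<noteq> 0" and "q \<notin> {p + 1, p + 2}"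
    and "m = min p q"
  shows "\<exists>h f \<iota>.
    primitive_idempotent p q h \<and>
    recovering_factor p q (2 * m) {kahler_form m} \<iota> h f \<and>
    (\<exists>e\<in>clifford p q. h = clifford_mult p f e \<and>
      symbol_map h = PQ m (relabel \<iota> (kahler_form m)) \<and>\<^sub>\<Lambda> symbol_map e)"
proof -
  have m: "m \<le> p" "m \<le> q"
    using assms(5) by simp_all
  interpret paired_generators p q m
    using m by unfold_locales
  have "finite ({1..p + q} - pairs p {1..m})"
    by simp
  then obtain e where e: "e \<in> R" "e \<noteq> 0" "idempotent p e"
    "\<And>a b. a \<in> R \<Longrightarrow> b \<in> R \<Longrightarrow> a \<noteq> 0 \<Longrightarrow> b \<noteq> 0 \<Longrightarrow> idempotent p a \<Longrightarrow> idempotent p b \<Longrightarrow>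
      clifford_mult p a b = 0 \<Longrightarrow> clifford_mult p b a = 0 \<Longrightarrow> e \<noteq> a + b"
    by (rule exists_primitive_idempotent[where p = p]) (use that in blast)
  have e_in: "e \<in> clifford p q"
    using e(1) by (rule R_in)
  have "primitive_idempotent p q (clifford_mult p f e)"
    using e by (rule primitive_f_mult)
  moreover have "recovering_factor p q (2 * m) {kahler_form m} (pair_labels p m)
      (clifford_mult p f e) f"
    unfolding recovering_factor_def using pair_idempotent_recovers[OF m assms(1)] e_in by blast
  moreover have "symbol_map (clifford_mult p f e) =
      PQ m (relabel (pair_labels p m) (kahler_form m)) \<and>\<^sub>\<Lambda> symbol_map e"
  proof -
    have symbol: "symbol_map x = x" if "x \<in> clifford p q" for x
      using that by (intro symbol_map_eq[of "{1..p + q}"]) (auto simp: multivectors_eq_supported)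
    \<comment> \<open>As \<open>symbol_map\<close> fixes \<open>f \<cdot> e\<close> and
      \<open>e\<close>, the splitting reduces to this equality of products and to
      \<open>PQ_pairs\<close>.\<close>
    have "clifford_mult p f e = f \<and>\<^sub>\<Lambda> e"
      unfolding clifford_mult_def wedge_def
      by (rule diag_prod_disjoint[OF f_in_supported e(1)]) auto
    then show ?thesis
      using symbol[OF mult_in[OF f_in e_in]] symbol[OF e_in] m(1)
      by (simp add: relabel_kahler_form PQ_pairs)
  qed
  ultimately show ?thesis
    using e_in by blast
qed

end
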